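(* There is an algorithm that, given an event graph $G=(V,E)$, a node $v\in V$ and a subset $X\subseteq\mathcal U_{|V}$, decides in $O(|V|+|E|)$ time whether $(v,X)$ is a node of the unique sink component $\mathcal C$ of $\mathrm{dec}(G)$.
   Context: An event graph is a finite, connected, undirected graph $G=(V,E)$, with $n=|V|$, in which every node $v$ carries a label that is either $\mathtt{i}x_v$ (insertion of $x_v$) or $\mathtt{d}x_v$ (deletion of $x_v$), where $x_v$ is an element of a finite universe $\mathcal U$. Write $\mathcal U_{|V}=\{x_v : v\in V\}$. It is assumed that for each $x\in\mathcal U_{|V}$ at least one node is labeled $\mathtt{i}x$ and at least one node is labeled $\mathtt{d}x$. The decorated graph $\mathrm{dec}(G)$ is the directed graph with vertex set $V\times 2^{\mathcal U_{|V}}$ in which $((u,X),(v,Y))$ is an edge if and only if $\{u,v\}\in E$ and $Y=X\cup\{x_v\}$ when $v$ is labeled $\mathtt{i}x_v$, respectively $Y=X\setminus\{x_v\}$ when $v$ is labeled $\mathtt{d}x_v$. A sink component of $\mathrm{dec}(G)$ is a strongly connected component of $\mathrm{dec}(G)$ from which no edge leads to a different strongly connected component; $\mathrm{dec}(G)$ has exactly one sink component, denoted $\mathcal C$. *)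

theory Defs
  imports Main
begin

section \<open>Event graphs (concrete encoding)\<close>

text \<open>Nodes are 0..n-1. The label of node v is lab v = (b, x): b = True means
  insertion of x, b = False means deletion of x. Universe elements are natural numbers.
  Edges are given as a list of pairs, each undirected edge listed exactly once.\<close>

definition adj :: "(nat \<times> nat) list \<Rightarrow> nat \<Rightarrow> nat \<Rightarrow> bool" where
  "adj es u w \<longleftrightarrow> (u, w) \<in> set es \<or> (w, u) \<in> set es"

definition elems :: "nat \<Rightarrow> (nat \<Rightarrow> bool \<times> nat) \<Rightarrow> nat set" where
  "elems n lab = {snd (lab v) | v. v < n}"

definition event_graph :: "nat \<Rightarrow> (nat \<Rightarrow> bool \<times> nat) \<Rightarrow> (nat \<times> nat) list \<Rightarrow> bool" where
  "event_graph n lab es \<longleftrightarrow>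
     0 < n \<and>
     (\<forall>(u, w) \<in> set es. u < n \<and> w < n \<and> u \<noteq> w) \<and>
     distinct es \<and> (\<forall>(u, w) \<in> set es. (w, u) \<notin> set es) \<and>
     (\<forall>u < n. \<forall>w < n. (u, w) \<in> {(a, b). adj es a b}\<^sup>*) \<and>
     (\<forall>x \<in> elems n lab. (\<exists>v < n. lab v = (True, x)) \<and> (\<exists>v < n. lab v = (False, x)))"

section \<open>Decorated graph and its sink components\<close>

definition dec_vertices :: "nat \<Rightarrow> (nat \<Rightarrow> bool \<times> nat) \<Rightarrow> (nat \<times> nat set) set" where
  "dec_vertices n lab = {(v, X). v < n \<and> X \<subseteq> elems n lab}"

definition dec_edges :: "nat \<Rightarrow> (nat \<Rightarrow> bool \<times> nat) \<Rightarrow> (nat \<times> nat) list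
    \<Rightarrow> ((nat \<times> nat set) \<times> (nat \<times> nat set)) set" where
  "dec_edges n lab es = {((u, X), (v, Y)).
      (u, X) \<in> dec_vertices n lab \<and> (v, Y) \<in> dec_vertices n lab \<and> adj es u v \<and>
      Y = (if fst (lab v) then insert (snd (lab v)) X else X - {snd (lab v)})}"

text \<open>A strongly connected component of dec(G).\<close>
definition dec_scc :: "nat \<Rightarrow> (nat \<Rightarrow> bool \<times> nat) \<Rightarrow> (nat \<times> nat) list
    \<Rightarrow> (nat \<times> nat set) set \<Rightarrow> bool" where
  "dec_scc n lab es C \<longleftrightarrow>
     C \<noteq> {} \<and> C \<subseteq> dec_vertices n lab \<and>
     (\<forall>a \<in> C. \<forall>b \<in> C. (a, b) \<in> (dec_edges n lab es)\<^sup>*) \<and>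
     (\<forall>a \<in> C. \<forall>b. (a, b) \<in> (dec_edges n lab es)\<^sup>* \<and> (b, a) \<in> (dec_edges n lab es)\<^sup>* \<longrightarrow> b \<in> C)"

text \<open>A sink component: an SCC from which no edge leaves.\<close>
definition dec_sink_component :: "nat \<Rightarrow> (nat \<Rightarrow> bool \<times> nat) \<Rightarrow> (nat \<times> nat) list
    \<Rightarrow> (nat \<times> nat set) set \<Rightarrow> bool" where
  "dec_sink_component n lab es C \<longleftrightarrow>
     dec_scc n lab es C \<and> (\<forall>a \<in> C. \<forall>b. (a, b) \<in> dec_edges n lab es \<longrightarrow> b \<in> C)"

section \<open>Machine model: unit-cost RAM (integer registers, indirect addressing)\<close>

datatype instr =
    LoadConst nat int        (* M[r] := c *)
  | Add nat nat nat          (* M[r] := M[a] + M[b] *)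
  | Sub nat nat nat          (* M[r] := M[a] - M[b] *)
  | LoadInd nat nat          (* M[r] := M[M[a]] *)
  | StoreInd nat nat         (* M[M[a]] := M[r] ; arguments a r *)
  | Jz nat nat               (* if M[r] = 0 goto l *)
  | Jpos nat nat             (* if M[r] > 0 goto l *)
  | Halt

type_synonym ram_state = "nat \<times> (int \<Rightarrow> int)"

definition ram_halted :: "instr list \<Rightarrow> ram_state \<Rightarrow> bool" where
  "ram_halted P s \<longleftrightarrow> length P \<le> fst s \<or> P ! fst s = Halt"

fun ram_exec :: "instr \<Rightarrow> ram_state \<Rightarrow> ram_state" where
  "ram_exec (LoadConst r c) (pc, M) = (Suc pc, M(int r := c))"
| "ram_exec (Add r a b) (pc, M) = (Suc pc, M(int r := M (int a) + M (int b)))"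
| "ram_exec (Sub r a b) (pc, M) = (Suc pc, M(int r := M (int a) - M (int b)))"
| "ram_exec (LoadInd r a) (pc, M) = (Suc pc, M(int r := M (M (int a))))"
| "ram_exec (StoreInd a r) (pc, M) = (Suc pc, M(M (int a) := M (int r)))"
| "ram_exec (Jz r l) (pc, M) = (if M (int r) = 0 then l else Suc pc, M)"
| "ram_exec (Jpos r l) (pc, M) = (if M (int r) > 0 then l else Suc pc, M)"
| "ram_exec Halt (pc, M) = (pc, M)"

definition ram_step :: "instr list \<Rightarrow> ram_state \<Rightarrow> ram_state" where
  "ram_step P s = (if ram_halted P s then s else ram_exec (P ! fst s) s)"

definition ram_run :: "instr list \<Rightarrow> nat \<Rightarrow> ram_state \<Rightarrow> ram_state" where
  "ram_run P t s = (ram_step P ^^ t) s"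

text \<open>Input layout in memory (all other cells are 0):
  M[0] = n, M[1] = number of edges m, M[2] = v, M[3] = |X|;
  M[4+2i], M[5+2i] = (1 if node i is an insertion else 0, element of node i), i < n;
  M[4+2n+2j], M[5+2n+2j] = endpoints of edge j, j < m;
  M[4+2n+2m+k] = k-th element of X, k < |X|.\<close>
definition input_mem :: "nat \<Rightarrow> (nat \<Rightarrow> bool \<times> nat) \<Rightarrow> (nat \<times> nat) list \<Rightarrow> nat
    \<Rightarrow> nat list \<Rightarrow> int \<Rightarrow> int" where
  "input_mem n lab es v xs a =
    (let m = length es; N = int n; Mm = int m in
     if a = 0 then N
     else if a = 1 then Mm
     else if a = 2 then int v
     else if a = 3 then int (length xs)
     else if 4 \<le> a \<and> a < 4 + 2 * N then
       (let i = nat ((a - 4) div 2) in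
        if (a - 4) mod 2 = 0 then (if fst (lab i) then 1 else 0) else int (snd (lab i)))
     else if 4 + 2 * N \<le> a \<and> a < 4 + 2 * N + 2 * Mm then
       (let j = nat ((a - 4 - 2 * N) div 2) in
        if (a - 4 - 2 * N) mod 2 = 0 then int (fst (es ! j)) else int (snd (es ! j)))
     else if 4 + 2 * N + 2 * Mm \<le> a \<and> a < 4 + 2 * N + 2 * Mm + int (length xs) then
       int (xs ! nat (a - 4 - 2 * N - 2 * Mm))
     else 0)"

end

theory Submission
  imports Defs
begin

text \<open>
  After a walk that covers all elements, the bit of each element is decided by the last visited node
  carrying it. Hence \<open>(v, X)\<close> lies in the sink component iff a walk starting at \<open>v\<close>, read backwards in
  time, covers all elements and visits each element for the first time at a node whose label agrees
  with \<open>X\<close>. Such walks can be built greedily: the set of nodes they can visit is closed under moving to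
  a neighbour that agrees with \<open>X\<close> or whose element has been met before, and the answer is positive iff
  this closure is all of \<open>V\<close>. The closure is a graph search with conjunctive vertices (a node needs a
  reached neighbour and an admissible label), which runs in linear time with adjacency lists, using one
  auxiliary vertex per element to release the nodes that carry it.
\<close>

section \<open>Sink membership as a backward search\<close>

text \<open>No sink component is computed: \<open>(v, X)\<close> lies in one exactly when every
  vertex of \<open>dec_vertices\<close> reaches it, and only walks ending there matter. A greedy
  closure can replace such a walk because a visited node may be re-entered freely: its element has
  been met, so its label no longer matters, and the walk can always return through visited nodes to
  extend elsewhere. The obstacle to linear time is that elements are arbitrary natural numbers, so
  no table over the universe may be scanned or cleared. Memory outside the input is zero at the
  start and all negative cells are free: fifteen arrays interleaved there with stride 16 can be
  indexed directly by element codes, and an entry never written reads as 0, which stands for an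
  unset flag or an empty arc list. Every loop is then charged to nodes, edges, arcs or listed
  members of the query set.\<close>

definition agrees :: "(nat \<Rightarrow> bool \<times> nat) \<Rightarrow> nat set \<Rightarrow> nat \<Rightarrow> bool" where
  "agrees lab X w \<longleftrightarrow> (fst (lab w) \<longleftrightarrow> snd (lab w) \<in> X)"

inductive back_reach :: "nat \<Rightarrow> (nat \<Rightarrow> bool \<times> nat) \<Rightarrow> (nat \<times> nat) list \<Rightarrow> nat \<Rightarrow> nat set \<Rightarrow> nat \<Rightarrow> bool"
  for n lab es v X where
  start: "v < n \<Longrightarrow> agrees lab X v \<Longrightarrow> back_reach n lab es v X v"
| agree: "back_reach n lab es v X u \<Longrightarrow> adj es u w \<Longrightarrow> w < n \<Longrightarrow> agrees lab X w \<Longrightarrow>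
    back_reach n lab es v X w"
| seen: "back_reach n lab es v X u \<Longrightarrow> adj es u w \<Longrightarrow> w < n \<Longrightarrow>
    back_reach n lab es v X w' \<Longrightarrow> snd (lab w') = snd (lab w) \<Longrightarrow> back_reach n lab es v X w"

definition update :: "(nat \<Rightarrow> bool \<times> nat) \<Rightarrow> nat \<Rightarrow> nat set \<Rightarrow> nat set" where
  "update lab w X = (if fst (lab w) then insert (snd (lab w)) X else X - {snd (lab w)})"

lemma adj_sym: "adj es u w \<Longrightarrow> adj es w u"
  by (auto simp: adj_def)

lemma mem_update:
  "x \<in> update lab w X \<longleftrightarrow> (if x = snd (lab w) then fst (lab w) else x \<in> X)"
  by (auto simp: update_def)

lemma event_graph_adj_less: "event_graph n lab es \<Longrightarrow> adj es u w \<Longrightarrow> u < n \<and> w < n"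
  by (auto simp: event_graph_def adj_def)

lemma snd_lab_elems: "w < n \<Longrightarrow> snd (lab w) \<in> elems n lab"
  by (auto simp: elems_def)

lemma update_subset: "w < n \<Longrightarrow> X \<subseteq> elems n lab \<Longrightarrow> update lab w X \<subseteq> elems n lab"
  by (auto simp: update_def snd_lab_elems)

lemma dec_edges_iff:
  assumes "event_graph n lab es"
  shows "((u, X), (w, Y)) \<in> dec_edges n lab es \<longleftrightarrow>
    X \<subseteq> elems n lab \<and> adj es u w \<and> Y = update lab w X"
  using event_graph_adj_less[OF assms, of u w] update_subset[of w n X lab]
  by (auto simp: dec_edges_def dec_vertices_def update_def[symmetric])

lemma dec_edgeI:
  "event_graph n lab es \<Longrightarrow> X \<subseteq> elems n lab \<Longrightarrow> adj es u w \<Longrightarrow>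
    ((u, X), (w, update lab w X)) \<in> dec_edges n lab es"
  by (simp add: dec_edges_iff)

text \<open>The element of \<open>u\<close> is both inserted and deleted somewhere, so a second node
  exists; connectivity then yields a neighbour. Hence some edge leaves every vertex of the decorated
  graph.\<close>

lemma event_graph_neighbour:
  assumes "event_graph n lab es" "u < n"
  shows "\<exists>w. adj es u w"
proof -
  have "snd (lab u) \<in> elems n lab" using assms by (auto simp: elems_def)
  then obtain a b where ab: "a < n" "lab a = (True, snd (lab u))" "b < n" "lab b = (False, snd (lab u))"
    using assms(1) by (fastforce simp: event_graph_def)
  then obtain w where "w < n" "w \<noteq> u" by (metis fst_conv)
  then have "(u, w) \<in> {(a, b). adj es a b}\<^sup>*"
    using assms by (auto simp: event_graph_def)
  then show ?thesis by (cases rule: converse_rtranclE) (use \<open>w \<noteq> u\<close> in auto)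
qed

lemma back_reach_start:
  "back_reach n lab es v X w \<Longrightarrow> agrees lab X v \<and> back_reach n lab es v X v"
  by (induction rule: back_reach.induct) (auto intro: start)

text \<open>Read backwards from \<open>(v, X)\<close>, the first visit of an element fixes its bit in \<open>X\<close>, so
  it has to agree with \<open>X\<close>; later visits are unconstrained.\<close>

lemma dec_path_back_reach:
  assumes eg: "event_graph n lab es"
    and path: "(a, (v, X)) \<in> (dec_edges n lab es)\<^sup>*"
  shows "(\<forall>x. (\<forall>w. back_reach n lab es v X w \<longrightarrow> snd (lab w) \<noteq> x) \<longrightarrow> (x \<in> snd a \<longleftrightarrow> x \<in> X)) \<and>
    (fst a = v \<or> (\<exists>u. back_reach n lab es v X u \<and> adj es (fst a) u))"
    and "(b, a) \<in> dec_edges n lab es \<Longrightarrow> back_reach n lab es v X (fst a)"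
proof -
  let ?I = "\<lambda>a. (\<forall>x. (\<forall>w. back_reach n lab es v X w \<longrightarrow> snd (lab w) \<noteq> x) \<longrightarrow> (x \<in> snd a \<longleftrightarrow> x \<in> X)) \<and>
    (fst a = v \<or> (\<exists>u. back_reach n lab es v X u \<and> adj es (fst a) u))"
  \<comment> \<open>Needed inside the induction and for the second claim. If the element of
    \<open>w\<close> has been met, rule \<open>seen\<close> applies, or \<open>w = v\<close>, which
    belongs to any nonempty closure. Otherwise its bit in \<open>Y\<close> equals its bit in
    \<open>X\<close> by the invariant, while the edge into \<open>a\<close> has just set it to the
    label of \<open>w\<close>. Without an incoming edge nothing would tie \<open>Y\<close> to the
    label.\<close>
  have entry: "back_reach n lab es v X (fst a)" if "(b, a) \<in> dec_edges n lab es" "?I a" for a b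
  proof -
    obtain u Z w Y where ba: "b = (u, Z)" "a = (w, Y)" by (cases a, cases b) auto
    have e: "adj es u w" "Y = update lab w Z" "w < n"
      using that(1) eg event_graph_adj_less[OF eg] by (auto simp: ba dec_edges_iff)
    show ?thesis
    proof (cases "\<exists>w'. back_reach n lab es v X w' \<and> snd (lab w') = snd (lab w)")
      case True
      then obtain w' where w': "back_reach n lab es v X w'" "snd (lab w') = snd (lab w)" by blast
      have "w = v \<or> (\<exists>u. back_reach n lab es v X u \<and> adj es u w)"
        using that(2) adj_sym unfolding ba fst_conv by blast
      then consider "w = v" | u where "back_reach n lab es v X u" "adj es u w" by blast
      then show ?thesis
      proof cases
        case 1
        then show ?thesis using back_reach_start[OF w'(1)] by (simp add: ba)
      next
        case 2
        then show ?thesis using seen[OF 2 e(3) w'] by (simp add: ba)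
      qed
    next
      case False
      then have "snd (lab w) \<in> Y \<longleftrightarrow> snd (lab w) \<in> X" using that(2) by (fastforce simp: ba)
      then have "agrees lab X w" using e by (simp add: agrees_def mem_update)
      then show ?thesis using that(2) e by (auto simp: ba intro: start agree adj_sym)
    qed
  qed
  have I: "?I a" using path
  proof (induction rule: converse_rtrancl_induct)
    case base
    then show ?case by simp
  next
    case (step b a)
    obtain u Z w Y where ba: "b = (u, Z)" "a = (w, Y)" by (cases a, cases b) auto
    have e: "adj es u w" "Y = update lab w Z"
      using step.hyps(1) eg by (auto simp: ba dec_edges_iff)
    have r: "back_reach n lab es v X w"
      using entry[OF step.hyps(1) step.IH]
      by (simp add: ba)
    have "x \<in> Z \<longleftrightarrow> x \<in> X" if "\<forall>w. back_reach n lab es v X w \<longrightarrow> snd (lab w) \<noteq> x" for x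
    proof -
      have "x \<noteq> snd (lab w)" using that r by blast
      moreover have "x \<in> Y \<longleftrightarrow> x \<in> X" using step.IH that by (simp add: ba)
      ultimately show ?thesis by (simp add: e mem_update)
    qed
    then show ?case using r e by (auto simp: ba)
  qed
  show "?I a" by (rule I)
  show "back_reach n lab es v X (fst a)" if "(b, a) \<in> dec_edges n lab es"
    using entry[OF that I] .
qed

lemma dec_walk:
  assumes eg: "event_graph n lab es" and X: "X \<subseteq> elems n lab"
    and "(u, w) \<in> {(a, b). adj es a b}\<^sup>*"
  shows "\<exists>Y. Y \<subseteq> elems n lab \<and> ((u, X), (w, Y)) \<in> (dec_edges n lab es)\<^sup>*"
  using assms(3)
proof (induction rule: rtrancl_induct)
  case base
  then show ?case using X by blast
next
  case (step w z)
  then obtain Y where Y: "Y \<subseteq> elems n lab" "((u, X), (w, Y)) \<in> (dec_edges n lab es)\<^sup>*"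
    by blast
  have "((w, Y), (z, update lab z Y)) \<in> dec_edges n lab es"
    using step.hyps dec_edgeI[OF eg Y(1)] by simp
  with Y(2) have "((u, X), (z, update lab z Y)) \<in> (dec_edges n lab es)\<^sup>*"
    by (rule rtrancl_into_rtrancl)
  then show ?case using event_graph_adj_less[OF eg, of w z] step.hyps update_subset[OF _ Y(1)] by blast
qed

text \<open>Walk from \<open>(v, X)\<close> to a neighbour \<open>z\<close> of \<open>w\<close>,
  step into \<open>w\<close>, and return by strong connectivity, since nothing leaves
  \<open>C\<close>. The detour through \<open>z\<close> supplies the incoming edge required by
  \<open>dec_path_back_reach\<close>, also when \<open>w = v\<close>.\<close>

lemma sink_imp_back_reach:
  assumes eg: "event_graph n lab es" and C: "dec_sink_component n lab es C" "(v, X) \<in> C" and w: "w < n"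
  shows "back_reach n lab es v X w"
proof -
  have vX: "v < n" "X \<subseteq> elems n lab"
    using C by (auto simp: dec_sink_component_def dec_scc_def dec_vertices_def)
  obtain z where z: "adj es z w" using event_graph_neighbour[OF eg w] adj_sym by blast
  then have "z < n" using event_graph_adj_less[OF eg] by blast
  then have "(v, z) \<in> {(a, b). adj es a b}\<^sup>*" using eg vX by (auto simp: event_graph_def)
  from dec_walk[OF eg vX(2) this] obtain Y where
    Y: "Y \<subseteq> elems n lab" "((v, X), (z, Y)) \<in> (dec_edges n lab es)\<^sup>*" by blast
  have e: "((z, Y), (w, update lab w Y)) \<in> dec_edges n lab es" by (rule dec_edgeI[OF eg Y(1) z])
  have "b \<in> C" if "((v, X), b) \<in> (dec_edges n lab es)\<^sup>*" for b
    using that by (induction rule: rtrancl_induct) (use C in \<open>auto simp: dec_sink_component_def\<close>)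
  then have "(w, update lab w Y) \<in> C" using Y(2) e by (meson rtrancl_into_rtrancl)
  then have "((w, update lab w Y), (v, X)) \<in> (dec_edges n lab es)\<^sup>*"
    using C unfolding dec_sink_component_def dec_scc_def by blast
  from dec_path_back_reach(2)[OF eg this e] show ?thesis by simp
qed

section \<open>Greedy search and the forward walks it yields\<close>

inductive discovered :: "nat \<Rightarrow> (nat \<Rightarrow> bool \<times> nat) \<Rightarrow> (nat \<times> nat) list \<Rightarrow> nat \<Rightarrow> nat set \<Rightarrow> nat set \<Rightarrow> bool"
  for n lab es v X where
  init: "v < n \<Longrightarrow> agrees lab X v \<Longrightarrow> discovered n lab es v X {v}"
| grow: "discovered n lab es v X W \<Longrightarrow> u \<in> W \<Longrightarrow> adj es u w \<Longrightarrow> w < n \<Longrightarrow>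
    agrees lab X w \<or> snd (lab w) \<in> (snd \<circ> lab) ` W \<Longrightarrow> discovered n lab es v X (insert w W)"

lemma discovered_subset: "discovered n lab es v X W \<Longrightarrow> W \<subseteq> {..<n} \<and> v \<in> W"
  by (induction rule: discovered.induct) auto

text \<open>\<open>discovered\<close> records an order of discovery, which \<open>back_reach\<close>
  lacks. Rule \<open>seen\<close> has two recursive premises, so derivations do not translate
  directly into a sequence; a maximal discovered set is taken instead, and it absorbs every node
  that either rule could add.\<close>

lemma discovered_all:
  assumes v: "v < n" and R: "\<And>w. w < n \<Longrightarrow> back_reach n lab es v X w"
  shows "discovered n lab es v X {..<n}"
proof -
  have "agrees lab X v"
    using R[OF v] back_reach_start by blast
  then have "discovered n lab es v X {v}" using v by (rule init[rotated])
  moreover have "finite {W. discovered n lab es v X W}"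
    by (rule finite_subset[of _ "Pow {..<n}"]) (auto dest: discovered_subset)
  ultimately obtain W where W: "discovered n lab es v X W"
    and max: "\<And>W'. discovered n lab es v X W' \<Longrightarrow> W \<subseteq> W' \<Longrightarrow> W' = W"
    using finite_has_maximal[of "{W. discovered n lab es v X W}"] by auto
  have "w \<in> W" if "back_reach n lab es v X w" for w
    using that
  proof (induction rule: back_reach.induct)
    case start
    then show ?case using discovered_subset[OF W] by simp
  next
    case (agree u w)
    then have "discovered n lab es v X (insert w W)" by (intro grow[OF W]) auto
    from max[OF this] show ?case by blast
  next
    case (seen u w w')
    then have "discovered n lab es v X (insert w W)"
      by (intro grow[OF W]) (auto simp: image_iff intro: bexI[of _ w'])
    from max[OF this] show ?case by blast
  qed
  then have "W = {..<n}" using R discovered_subset[OF W] by blast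
  then show ?thesis using W by simp
qed

text \<open>Each new node is attached to an older one, so the subgraph induced by \<open>W\<close>
  is connected. Moving inside \<open>W\<close> leaves the bits of all elements outside
  \<open>W\<close> alone.\<close>

lemma discovered_walk:
  assumes "event_graph n lab es" "discovered n lab es v X W"
    and "u \<in> W" "w \<in> W"
  shows "(u, w) \<in> {(a, b). adj es a b \<and> a \<in> W \<and> b \<in> W}\<^sup>*"
  using assms(2-)
proof (induction arbitrary: u w rule: discovered.induct)
  case init
  then show ?case by simp
next
  case (grow W z y)
  let ?r = "{(a, b). adj es a b \<and> a \<in> W \<and> b \<in> W}"
  let ?r' = "{(a, b). adj es a b \<and> a \<in> insert y W \<and> b \<in> insert y W}"
  have mono: "?r\<^sup>* \<subseteq> ?r'\<^sup>*" by (rule rtrancl_mono) auto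
  have zy: "(z, y) \<in> ?r'" "(y, z) \<in> ?r'" using grow.hyps by (auto intro: adj_sym)
  have z: "(u, z) \<in> ?r'\<^sup>* \<and> (z, u) \<in> ?r'\<^sup>*" if "u \<in> insert y W" for u
    using that zy grow.IH mono grow.hyps(2) by (cases "u = y") blast+
  show ?case using z[OF grow.prems(1)] z[OF grow.prems(2)] by (meson rtrancl_trans)
qed

lemma agrees_update: "agrees lab (update lab w Z) w"
  by (simp add: agrees_def mem_update)

text \<open>Every step writes only an element carried by \<open>W\<close>, and after a step the
  current set agrees with the current node; for the empty walk that agreement is the hypothesis on
  \<open>u\<close>.\<close>

lemma dec_walk_within:
  assumes eg: "event_graph n lab es"
    and "(u, w) \<in> {(a, b). adj es a b \<and> a \<in> W \<and> b \<in> W}\<^sup>*"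
    and "Z \<subseteq> elems n lab" "agrees lab Z u"
  shows "\<exists>Y. Y \<subseteq> elems n lab \<and> agrees lab Y w \<and> ((u, Z), (w, Y)) \<in> (dec_edges n lab es)\<^sup>* \<and>
    (\<forall>x. x \<notin> (snd \<circ> lab) ` W \<longrightarrow> (x \<in> Y \<longleftrightarrow> x \<in> Z))"
  using assms(2)
proof (induction rule: rtrancl_induct)
  case base
  then show ?case using assms by blast
next
  case (step w z)
  then obtain Y where Y: "Y \<subseteq> elems n lab" "((u, Z), (w, Y)) \<in> (dec_edges n lab es)\<^sup>*"
    "\<forall>x. x \<notin> (snd \<circ> lab) ` W \<longrightarrow> (x \<in> Y \<longleftrightarrow> x \<in> Z)" by blast
  have wz: "adj es w z" "z < n" "z \<in> W" using step.hyps event_graph_adj_less[OF eg] by auto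
  show ?case
  proof (intro exI conjI)
    show "((u, Z), (z, update lab z Y)) \<in> (dec_edges n lab es)\<^sup>*"
      using Y(2) dec_edgeI[OF eg Y(1) wz(1)] by (rule rtrancl_into_rtrancl)
    show "\<forall>x. x \<notin> (snd \<circ> lab) ` W \<longrightarrow> (x \<in> update lab z Y \<longleftrightarrow> x \<in> Z)"
      using Y(3) wz(3) by (auto simp: mem_update)
  qed (use update_subset[OF wz(2) Y(1)] agrees_update in auto)
qed

text \<open>The forward walk undoes the order of discovery: go to the node \<open>w\<close> found
  last, step to its discoverer \<open>z\<close>, and continue with the smaller set \<open>W\<close>.
  If the element of \<open>w\<close> is new to \<open>W\<close>, rule \<open>grow\<close> made
  \<open>w\<close> agree with \<open>X\<close>, so the visit leaves the right bit behind. Elements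
  carried by \<open>W\<close> may be scrambled, since later stages settle them.\<close>

lemma discovered_reaches:
  assumes eg: "event_graph n lab es" and "discovered n lab es v X W"
    and "u \<in> W" "Z \<subseteq> elems n lab" "X \<subseteq> elems n lab" "agrees lab Z u"
    and "\<forall>x. x \<notin> (snd \<circ> lab) ` W \<longrightarrow> (x \<in> Z \<longleftrightarrow> x \<in> X)"
  shows "((u, Z), (v, X)) \<in> (dec_edges n lab es)\<^sup>*"
  using assms(2-)
proof (induction arbitrary: u Z rule: discovered.induct)
  case init
  then have "x \<in> Z \<longleftrightarrow> x \<in> X" for x
    by (cases "x = snd (lab v)") (auto simp: agrees_def)
  then have "Z = X" by blast
  then show ?case using init by simp
next
  case (grow W z w)
  have W': "discovered n lab es v X (insert w W)"
    using grow.hyps by (rule discovered.grow)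
  have "(u, w) \<in> {(a, b). adj es a b \<and> a \<in> insert w W \<and> b \<in> insert w W}\<^sup>*"
    by (rule discovered_walk[OF eg W' grow.prems(1)]) simp
  from dec_walk_within[OF eg this grow.prems(2) grow.prems(4)]
  obtain Y where Y: "Y \<subseteq> elems n lab" "agrees lab Y w" "((u, Z), (w, Y)) \<in> (dec_edges n lab es)\<^sup>*"
    "\<forall>x. x \<notin> (snd \<circ> lab) ` insert w W \<longrightarrow> (x \<in> Y \<longleftrightarrow> x \<in> Z)" by blast
  have z: "z < n" using discovered_subset[OF grow.hyps(1)] grow.hyps(2) by auto
  have Yx: "x \<in> Y \<longleftrightarrow> x \<in> X" if "x \<notin> (snd \<circ> lab) ` W" for x
  proof (cases "x = snd (lab w)")
    case True
    then have "agrees lab X w" using grow.hyps(5) that by auto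
    then show ?thesis using Y(2) True by (auto simp: agrees_def)
  next
    case False
    then show ?thesis using Y(4) grow.prems(5) that by auto
  qed
  have "((w, Y), (z, update lab z Y)) \<in> dec_edges n lab es"
    by (rule dec_edgeI[OF eg Y(1) adj_sym[OF grow.hyps(3)]])
  moreover have "((z, update lab z Y), (v, X)) \<in> (dec_edges n lab es)\<^sup>*"
  proof (rule grow.IH)
    show "\<forall>x. x \<notin> (snd \<circ> lab) ` W \<longrightarrow> (x \<in> update lab z Y \<longleftrightarrow> x \<in> X)"
      using Yx grow.hyps(2) by (auto simp: mem_update)
  qed (use grow update_subset[OF z Y(1)] agrees_update in auto)
  ultimately show ?case using Y(3) by (meson converse_rtrancl_into_rtrancl rtrancl_trans)
qed

text \<open>Once every vertex reaches \<open>(v, X)\<close>, the set of vertices reachable from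
  \<open>(v, X)\<close> is strongly connected, and nothing leaves it by construction.\<close>

lemma back_reach_imp_sink:
  assumes eg: "event_graph n lab es" and v: "v < n" and X: "X \<subseteq> elems n lab"
    and R: "\<And>w. w < n \<Longrightarrow> back_reach n lab es v X w"
  shows "\<exists>C. dec_sink_component n lab es C \<and> (v, X) \<in> C"
proof -
  define C where "C = {b. ((v, X), b) \<in> (dec_edges n lab es)\<^sup>*}"
  have to: "(b, (v, X)) \<in> (dec_edges n lab es)\<^sup>*" if "b \<in> dec_vertices n lab" for b
  proof -
    obtain u Z where b: "b = (u, Z)" by (cases b)
    with that have uZ: "u < n" "Z \<subseteq> elems n lab" by (auto simp: dec_vertices_def)
    obtain w where w: "adj es u w" using event_graph_neighbour[OF eg uZ(1)] by blast
    then have wn: "w < n" using event_graph_adj_less[OF eg] by blast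
    \<comment> \<open>One edge is taken first because \<open>discovered_reaches\<close> wants a set
      agreeing with the node it stands at, which \<open>Z\<close> need not do at \<open>u\<close>.
      With all nodes discovered, the condition on the remaining elements holds because both sets lie
      in \<open>elems n lab\<close>.\<close>
    have "((w, update lab w Z), (v, X)) \<in> (dec_edges n lab es)\<^sup>*"
    proof (rule discovered_reaches[OF eg discovered_all[OF v R]])
      have "(snd \<circ> lab) ` {..<n} = elems n lab" by (auto simp: elems_def)
      then show "\<forall>x. x \<notin> (snd \<circ> lab) ` {..<n} \<longrightarrow> (x \<in> update lab w Z \<longleftrightarrow> x \<in> X)"
        using update_subset[OF wn uZ(2)] X by auto
    qed (use wn update_subset[OF wn uZ(2)] X agrees_update in auto)
    then show ?thesis using dec_edgeI[OF eg uZ(2) w] b by (meson converse_rtrancl_into_rtrancl)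
  qed
  have sub: "C \<subseteq> dec_vertices n lab"
  proof
    fix b assume "b \<in> C"
    then have "((v, X), b) \<in> (dec_edges n lab es)\<^sup>*" by (simp add: C_def)
    then show "b \<in> dec_vertices n lab"
      by (cases rule: rtranclE) (use v X in \<open>auto simp: dec_vertices_def dec_edges_def\<close>)
  qed
  have "dec_sink_component n lab es C"
    unfolding dec_sink_component_def dec_scc_def
  proof (intro conjI ballI allI impI)
    show "C \<noteq> {}" by (auto simp: C_def)
    show "(a, b) \<in> (dec_edges n lab es)\<^sup>*" if "a \<in> C" "b \<in> C" for a b
      using rtrancl_trans[of a "(v, X)" _ b] to[of a] that sub by (auto simp: C_def)
    show "b \<in> C" if "a \<in> C" "(a, b) \<in> (dec_edges n lab es)\<^sup>* \<and> (b, a) \<in> (dec_edges n lab es)\<^sup>*" for a b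
      using rtrancl_trans[of "(v, X)" a _ b] that by (simp add: C_def)
    show "b \<in> C" if "a \<in> C" "(a, b) \<in> dec_edges n lab es" for a b
      using rtrancl_into_rtrancl[of "(v, X)" a _ b] that by (simp add: C_def)
  qed (rule sub)
  then show ?thesis by (auto simp: C_def)
qed

theorem sink_iff_back_reach:
  assumes "event_graph n lab es" "v < n" "X \<subseteq> elems n lab"
  shows "(\<exists>C. dec_sink_component n lab es C \<and> (v, X) \<in> C) \<longleftrightarrow>
    (\<forall>w < n. back_reach n lab es v X w)"
  using sink_imp_back_reach[OF assms(1)] back_reach_imp_sink[OF assms] by blast

section \<open>A structured language on top of the machine\<close>

datatype com =
    Const nat int
  | Plus nat nat nat
  | Minus nat nat nat
  | Fetch nat nat nat
  | Put nat nat nat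
  | Seq com com (infixr \<open>;;\<close> 60)
  | Ifpos nat com com
  | While nat com

text \<open>Registers and a heap of arrays; \<open>Fetch r k a\<close> reads entry \<open>R a\<close> of array \<open>k\<close>.\<close>

type_synonym store = "(nat \<Rightarrow> int) \<times> (nat \<Rightarrow> int \<Rightarrow> int)"

definition heap_upd :: "(nat \<Rightarrow> int \<Rightarrow> int) \<Rightarrow> nat \<Rightarrow> int \<Rightarrow> int \<Rightarrow> nat \<Rightarrow> int \<Rightarrow> int" where
  "heap_upd H k z y = H(k := (H k)(z := y))"

lemma heap_upd_apply: "heap_upd H k z y k' z' = (if k' = k \<and> z' = z then y else H k' z')"
  by (simp add: heap_upd_def)

lemma heap_upd_other: "k' \<noteq> k \<Longrightarrow> heap_upd H k z y k' = H k'"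
  by (simp add: heap_upd_def)

text \<open>Array accesses have rules only for arrays 1 to 15 and non-negative indices: in that
  range the cells \<open>-16 * z - k\<close> are pairwise distinct and disjoint from the
  registers.\<close>

inductive exec :: "com \<Rightarrow> store \<Rightarrow> nat \<Rightarrow> store \<Rightarrow> bool" where
  Const: "exec (Const r c) (R, H) 1 (R(r := c), H)"
| Plus: "exec (Plus r a b) (R, H) 1 (R(r := R a + R b), H)"
| Minus: "exec (Minus r a b) (R, H) 1 (R(r := R a - R b), H)"
| Fetch: "1 \<le> k \<Longrightarrow> k \<le> 15 \<Longrightarrow> 0 \<le> R a \<Longrightarrow> exec (Fetch r k a) (R, H) 1 (R(r := H k (R a)), H)"
| Put: "1 \<le> k \<Longrightarrow> k \<le> 15 \<Longrightarrow> 0 \<le> R a \<Longrightarrow> exec (Put k a r) (R, H) 1 (R, heap_upd H k (R a) (R r))"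
| Seq: "exec c s t s' \<Longrightarrow> exec d s' t' s'' \<Longrightarrow> exec (c ;; d) s (t + t') s''"
| IfT: "fst s r > 0 \<Longrightarrow> exec c s t s' \<Longrightarrow> exec (Ifpos r c d) s (t + 1) s'"
| IfF: "\<not> fst s r > 0 \<Longrightarrow> exec d s t s' \<Longrightarrow> exec (Ifpos r c d) s (t + 1) s'"
| WhileT: "fst s r > 0 \<Longrightarrow> exec c s t s' \<Longrightarrow> exec (While r c) s' t' s'' \<Longrightarrow>
    exec (While r c) s (t + t' + 1) s''"
| WhileF: "\<not> fst s r > 0 \<Longrightarrow> exec (While r c) s 1 s"

fun csize :: "com \<Rightarrow> nat" where
  "csize (Const r c) = 1"
| "csize (Plus r a b) = 1"
| "csize (Minus r a b) = 1"
| "csize (Fetch r k a) = 9"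
| "csize (Put k a r) = 9"
| "csize (c ;; d) = csize c + csize d"
| "csize (Ifpos r c d) = 3 + csize d + csize c"
| "csize (While r c) = 5 + csize c"

text \<open>Entry \<open>z\<close> of array \<open>k\<close> lives in cell \<open>-16 z - k\<close>, register \<open>r\<close> in cell \<open>r + 2\<close>; cells 0 and 1
  are scratch. Unconditional jumps test a freshly zeroed cell 0.\<close>

definition address :: "nat \<Rightarrow> nat \<Rightarrow> instr list" where
  "address k a = [LoadConst 0 0, Sub 0 0 (a + 2), Add 0 0 0, Add 0 0 0, Add 0 0 0, Add 0 0 0,
     LoadConst 1 (- int k), Add 0 0 1]"

lemma length_address [simp]: "length (address k a) = 8"
  by (simp add: address_def)

fun compile :: "nat \<Rightarrow> com \<Rightarrow> instr list" where
  "compile l (Const r c) = [LoadConst (r + 2) c]"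
| "compile l (Plus r a b) = [Add (r + 2) (a + 2) (b + 2)]"
| "compile l (Minus r a b) = [Sub (r + 2) (a + 2) (b + 2)]"
| "compile l (Fetch r k a) = address k a @ [LoadInd (r + 2) 0]"
| "compile l (Put k a r) = address k a @ [StoreInd 0 (r + 2)]"
| "compile l (c ;; d) = compile l c @ compile (l + csize c) d"
| "compile l (Ifpos r c d) =
    Jpos (r + 2) (l + 3 + csize d) # compile (l + 1) d @
    [LoadConst 0 0, Jz 0 (l + 3 + csize d + csize c)] @ compile (l + 3 + csize d) c"
| "compile l (While r c) =
    [Jpos (r + 2) (l + 3), LoadConst 0 0, Jz 0 (l + 5 + csize c)] @ compile (l + 3) c @
    [LoadConst 0 0, Jz 0 l]"

lemma length_compile [simp]: "length (compile l c) = csize c"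
  by (induction c arbitrary: l) (auto simp: address_def)

section \<open>Simulation of the structured language by the machine\<close>

definition code_at :: "instr list \<Rightarrow> nat \<Rightarrow> instr list \<Rightarrow> bool" where
  "code_at P l is \<longleftrightarrow> (\<exists>pre post. P = pre @ is @ post \<and> length pre = l)"

lemma code_at_append:
  "code_at P l (is @ js) \<longleftrightarrow> code_at P l is \<and> code_at P (l + length is) js"
proof
  assume "code_at P l (is @ js)"
  then obtain pre post where p: "P = pre @ (is @ js) @ post" "length pre = l"
    by (auto simp: code_at_def)
  have "P = pre @ is @ (js @ post)" "P = (pre @ is) @ js @ post" using p by auto
  then show "code_at P l is \<and> code_at P (l + length is) js"
    using p(2) unfolding code_at_def by (metis length_append)
next
  assume "code_at P l is \<and> code_at P (l + length is) js"
  then obtain pre post pre' post' where p: "P = pre @ is @ post" "length pre = l"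
    "P = pre' @ js @ post'" "length pre' = l + length is"
    unfolding code_at_def by blast
  have "pre' = take (l + length is) P" using p(3,4) by simp
  also have "\<dots> = pre @ is" using p(1,2) by simp
  finally show "code_at P l (is @ js)" using p by (auto simp: code_at_def)
qed

lemma code_at_Cons:
  "code_at P l (i # is) \<longleftrightarrow> l < length P \<and> P ! l = i \<and> code_at P (Suc l) is"
proof -
  have "code_at P l [i] \<longleftrightarrow> l < length P \<and> P ! l = i"
  proof
    assume "code_at P l [i]"
    then show "l < length P \<and> P ! l = i" by (auto simp: code_at_def nth_append)
  next
    assume l: "l < length P \<and> P ! l = i"
    then have "P = take l P @ [i] @ drop (Suc l) P" using id_take_nth_drop[of l P] by simp
    then show "code_at P l [i]" unfolding code_at_def using l
      by (intro exI[of _ "take l P"] exI[of _ "drop (Suc l) P"]) simp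
  qed
  then show ?thesis using code_at_append[of P l "[i]" "is"] by simp
qed

lemma ram_run_0 [simp]: "ram_run P 0 s = s"
  by (simp add: ram_run_def)

lemma ram_run_Suc: "ram_run P (Suc j) s = ram_run P j (ram_step P s)"
  by (simp add: ram_run_def funpow_swap1)

lemma ram_run_add: "ram_run P (i + j) s = ram_run P j (ram_run P i s)"
  by (simp add: ram_run_def funpow_add add.commute[of i])

lemma ram_step_instr:
  "l < length P \<Longrightarrow> P ! l = i \<Longrightarrow> i \<noteq> Halt \<Longrightarrow> ram_step P (l, M) = ram_exec i (l, M)"
  by (simp add: ram_step_def ram_halted_def)

text \<open>Cells 0 and 1 and the negative multiples of 16 stay unconstrained, so address
  computations and jumps never disturb the store.\<close>

definition simulates :: "(int \<Rightarrow> int) \<Rightarrow> store \<Rightarrow> bool" where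
  "simulates M s \<longleftrightarrow> (\<forall>r. M (int r + 2) = fst s r) \<and>
    (\<forall>k z. 1 \<le> k \<and> k \<le> 15 \<and> 0 \<le> z \<longrightarrow> M (-16 * z - int k) = snd s k z)"

lemma heap_address_eq:
  assumes "1 \<le> k" "k \<le> 15" "1 \<le> k'" "k' \<le> (15 :: nat)"
  shows "-16 * z - int k = -16 * z' - int k' \<longleftrightarrow> z = z' \<and> k = k'"
  using assms by (cases z z' rule: linorder_cases) auto

lemma simulates_scratch:
  "simulates M s \<Longrightarrow> simulates (M(0 := a)) s" "simulates M s \<Longrightarrow> simulates (M(1 := a)) s"
  by (auto simp: simulates_def)

lemma simulates_reg:
  "simulates M (R, H) \<Longrightarrow> simulates (M(int r + 2 := a)) (R(r := a), H)"
  by (auto simp: simulates_def)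

lemma simulates_heap:
  assumes "simulates M (R, H)" "1 \<le> k" "k \<le> 15" "0 \<le> z"
  shows "simulates (M(-16 * z - int k := a)) (R, heap_upd H k z a)"
  unfolding simulates_def
proof (intro conjI allI impI)
  fix r
  have "int r + 2 \<noteq> -16 * z - int k" using assms(4) by linarith
  then show "(M(-16 * z - int k := a)) (int r + 2) = fst (R, heap_upd H k z a) r"
    using assms(1) by (simp add: simulates_def)
next
  fix k' z' assume "1 \<le> (k' :: nat) \<and> k' \<le> 15 \<and> 0 \<le> (z' :: int)"
  then show "(M(-16 * z - int k := a)) (-16 * z' - int k') = snd (R, heap_upd H k z a) k' z'"
    using assms heap_address_eq[of k' k z' z] by (simp add: simulates_def heap_upd_apply)
qed

lemma run_address:
  assumes "simulates M (R, H)" "code_at P l (address k a)"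
  shows "\<exists>M'. ram_run P 8 (l, M) = (l + 8, M') \<and> simulates M' (R, H) \<and> M' 0 = -16 * R a - int k"
proof -
  let ?M = "M(0 := -16 * R a - int k, 1 := - int k)"
  have "M (int a + 2) = R a" using assms(1) by (simp add: simulates_def)
  then have "ram_run P 8 (l, M) = (l + 8, ?M)"
    using assms(2)
    by (simp add: address_def code_at_Cons eval_nat_numeral ram_run_Suc ram_step_instr add.commute
        fun_eq_iff)
  then show ?thesis using assms(1) simulates_scratch by auto
qed

lemma simulationI:
  "ram_run P j s = (l, M) \<Longrightarrow> j \<le> b \<Longrightarrow> simulates M s' \<Longrightarrow>
    \<exists>j M. j \<le> b \<and> ram_run P j s = (l, M) \<and> simulates M s'"
  by blast

text \<open>The factor 9 comes from array access: eight instructions for the address and one for the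
  access. A test with its jumps adds at most three machine steps.\<close>

lemma compile_correct:
  assumes "exec c s t s'" "simulates M s" "code_at P l (compile l c)"
  shows "\<exists>j M'. j \<le> 9 * t \<and> ram_run P j (l, M) = (l + csize c, M') \<and> simulates M' s'"
  using assms
proof (induction arbitrary: l M rule: exec.induct)
  case (Const r c R H)
  then have "ram_run P 1 (l, M) = (l + 1, M(int r + 2 := c))"
    by (simp add: code_at_Cons ram_run_Suc ram_step_instr add.commute)
  from simulationI[OF this _ simulates_reg[OF Const.prems(1)]] show ?case by simp
next
  case (Plus r a b R H)
  then have "ram_run P 1 (l, M) = (l + 1, M(int r + 2 := R a + R b))"
    by (simp add: code_at_Cons ram_run_Suc ram_step_instr add.commute[of 2] simulates_def)
  from simulationI[OF this _ simulates_reg[OF Plus.prems(1)]] show ?case by simp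
next
  case (Minus r a b R H)
  then have "ram_run P 1 (l, M) = (l + 1, M(int r + 2 := R a - R b))"
    by (simp add: code_at_Cons ram_run_Suc ram_step_instr add.commute[of 2] simulates_def)
  from simulationI[OF this _ simulates_reg[OF Minus.prems(1)]] show ?case by simp
next
  case (Fetch k R a r H)
  have c: "code_at P l (address k a)" "l + 8 < length P" "P ! (l + 8) = LoadInd (r + 2) 0"
    using Fetch.prems(2) by (auto simp: code_at_append code_at_Cons)
  obtain M' where M': "ram_run P 8 (l, M) = (l + 8, M')" "simulates M' (R, H)"
    "M' 0 = -16 * R a - int k" using run_address[OF Fetch.prems(1) c(1)] by blast
  have "M' (-16 * R a - int k) = H k (R a)" using M'(2) Fetch.hyps by (simp add: simulates_def)
  then have "ram_run P (8 + 1) (l, M) = (l + 9, M'(int r + 2 := H k (R a)))"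
    using M'(3) ram_step_instr[OF c(2,3)]
    by (simp only: ram_run_add M'(1)) (simp add: ram_run_Suc add.commute)
  from simulationI[OF this _ simulates_reg[OF M'(2)]] show ?case by simp
next
  case (Put k R a r H)
  have c: "code_at P l (address k a)" "l + 8 < length P" "P ! (l + 8) = StoreInd 0 (r + 2)"
    using Put.prems(2) by (auto simp: code_at_append code_at_Cons)
  obtain M' where M': "ram_run P 8 (l, M) = (l + 8, M')" "simulates M' (R, H)"
    "M' 0 = -16 * R a - int k" using run_address[OF Put.prems(1) c(1)] by blast
  have "M' (int r + 2) = R r" using M'(2) by (simp add: simulates_def)
  then have "ram_run P (8 + 1) (l, M) = (l + 9, M'(-16 * R a - int k := R r))"
    using M'(3) ram_step_instr[OF c(2,3)]
    by (simp only: ram_run_add M'(1)) (simp add: ram_run_Suc add.commute)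
  from simulationI[OF this _ simulates_heap[OF M'(2) Put.hyps]] show ?case by simp
next
  case (Seq c s t s' d t' s'')
  have c: "code_at P l (compile l c)" "code_at P (l + csize c) (compile (l + csize c) d)"
    using Seq.prems(2) by (auto simp: code_at_append)
  obtain j M' where 1: "j \<le> 9 * t" "ram_run P j (l, M) = (l + csize c, M')" "simulates M' s'"
    using Seq.IH(1)[OF Seq.prems(1) c(1)] by blast
  obtain j' M'' where 2: "j' \<le> 9 * t'" "ram_run P j' (l + csize c, M') = (l + csize c + csize d, M'')"
    "simulates M'' s''" using Seq.IH(2)[OF 1(3) c(2)] by blast
  show ?case using 1 2 by (intro exI[of _ "j + j'"] exI[of _ M'']) (simp add: ram_run_add)
next
  case (IfT s r c t s' d)
  have c: "l < length P" "P ! l = Jpos (r + 2) (l + 3 + csize d)"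
    "code_at P (l + 3 + csize d) (compile (l + 3 + csize d) c)"
    using IfT.prems(2) by (auto simp: code_at_append code_at_Cons eval_nat_numeral)
  have "M (int r + 2) > 0" using IfT by (simp add: simulates_def)
  then have 1: "ram_run P 1 (l, M) = (l + 3 + csize d, M)"
    using ram_step_instr[OF c(1,2)] by (simp add: ram_run_Suc add.commute)
  obtain j M' where 2: "j \<le> 9 * t" "ram_run P j (l + 3 + csize d, M) = (l + 3 + csize d + csize c, M')"
    "simulates M' s'" using IfT.IH[OF IfT.prems(1) c(3)] by blast
  show ?case using 1 2 by (intro exI[of _ "1 + j"] exI[of _ M']) (simp only: ram_run_add, simp)
next
  case (IfF s r d t s' c)
  have c: "l < length P" "P ! l = Jpos (r + 2) (l + 3 + csize d)"
    "code_at P (l + 1) (compile (l + 1) d)"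
    "l + 1 + csize d < length P" "P ! (l + 1 + csize d) = LoadConst 0 0"
    "l + 2 + csize d < length P" "P ! (l + 2 + csize d) = Jz 0 (l + 3 + csize d + csize c)"
    using IfF.prems(2) by (auto simp: code_at_append code_at_Cons eval_nat_numeral)
  have "\<not> M (int r + 2) > 0" using IfF by (simp add: simulates_def)
  then have 1: "ram_run P 1 (l, M) = (l + 1, M)"
    using ram_step_instr[OF c(1,2)] by (simp add: ram_run_Suc add.commute)
  obtain j M' where 2: "j \<le> 9 * t" "ram_run P j (l + 1, M) = (l + 1 + csize d, M')"
    "simulates M' s'" using IfF.IH[OF IfF.prems(1) c(3)] by blast
  have 3: "ram_run P 2 (l + 1 + csize d, M') = (l + 3 + csize d + csize c, M'(0 := 0))"
    using ram_step_instr[OF c(4,5)] ram_step_instr[OF c(6,7)]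
    by (simp add: ram_run_Suc numeral_2_eq_2)
  have "ram_run P (1 + (j + 2)) (l, M) = (l + 3 + csize d + csize c, M'(0 := 0))"
    by (simp only: ram_run_add 1 2 3)
  from simulationI[OF this _ simulates_scratch(1)[OF 2(3)]] 2(1) show ?case by (simp add: add.assoc)
next
  case (WhileT s r c t s' t' s'')
  have c: "l < length P" "P ! l = Jpos (r + 2) (l + 3)"
    "code_at P (l + 3) (compile (l + 3) c)"
    "l + 3 + csize c < length P" "P ! (l + 3 + csize c) = LoadConst 0 0"
    "l + 4 + csize c < length P" "P ! (l + 4 + csize c) = Jz 0 l"
    using WhileT.prems(2) by (auto simp: code_at_append code_at_Cons eval_nat_numeral)
  have "M (int r + 2) > 0" using WhileT by (simp add: simulates_def)
  then have 1: "ram_run P 1 (l, M) = (l + 3, M)"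
    using ram_step_instr[OF c(1,2)] by (simp add: ram_run_Suc add.commute)
  obtain j M' where 2: "j \<le> 9 * t" "ram_run P j (l + 3, M) = (l + 3 + csize c, M')"
    "simulates M' s'" using WhileT.IH(1)[OF WhileT.prems(1) c(3)] by blast
  have 3: "ram_run P 2 (l + 3 + csize c, M') = (l, M'(0 := 0))"
    using ram_step_instr[OF c(4,5)] ram_step_instr[OF c(6,7)]
    by (simp add: ram_run_Suc numeral_eq_Suc)
  obtain j' M'' where 4: "j' \<le> 9 * t'" "ram_run P j' (l, M'(0 := 0)) = (l + csize (While r c), M'')"
    "simulates M'' s''" using WhileT.IH(2)[OF simulates_scratch(1)[OF 2(3)] WhileT.prems(2)] by blast
  show ?case using 1 2 3 4
    by (intro exI[of _ "1 + (j + (2 + j'))"] exI[of _ M'']) (simp only: ram_run_add, simp)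
next
  case (WhileF s r c)
  have c: "l < length P" "P ! l = Jpos (r + 2) (l + 3)"
    "l + 1 < length P" "P ! (l + 1) = LoadConst 0 0"
    "l + 2 < length P" "P ! (l + 2) = Jz 0 (l + 5 + csize c)"
    using WhileF.prems(2) by (auto simp: code_at_append code_at_Cons eval_nat_numeral)
  have "\<not> M (int r + 2) > 0" using WhileF by (simp add: simulates_def)
  then have "ram_run P 3 (l, M) = (l + 5 + csize c, M(0 := 0))"
    using ram_step_instr[OF c(1,2)] ram_step_instr[OF c(3,4)] ram_step_instr[OF c(5,6)]
    by (simp add: ram_run_Suc numeral_eq_Suc add.commute)
  from simulationI[OF this _ simulates_scratch(1)[OF WhileF.prems(1)]] show ?case by (simp add: add.commute add.left_commute)
qed

section \<open>Total correctness with time bounds\<close>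

definition terminates :: "com \<Rightarrow> store \<Rightarrow> nat \<Rightarrow> (store \<Rightarrow> bool) \<Rightarrow> bool" where
  "terminates c s b Q \<longleftrightarrow> (\<exists>t s'. t \<le> b \<and> exec c s t s' \<and> Q s')"

text \<open>Loops get \<open>False\<close> on purpose: the calculus covers loop-free code only,
  where the running time is at most \<open>csize\<close>, so no clock has to be carried along. Loops
  are left to \<open>terminates_While\<close>.\<close>

fun wp :: "com \<Rightarrow> (store \<Rightarrow> bool) \<Rightarrow> store \<Rightarrow> bool" where
  "wp (Const r c) Q s \<longleftrightarrow> Q ((fst s)(r := c), snd s)"
| "wp (Plus r a b) Q s \<longleftrightarrow> Q ((fst s)(r := fst s a + fst s b), snd s)"
| "wp (Minus r a b) Q s \<longleftrightarrow> Q ((fst s)(r := fst s a - fst s b), snd s)"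
| "wp (Fetch r k a) Q s \<longleftrightarrow> 1 \<le> k \<and> k \<le> 15 \<and> 0 \<le> fst s a \<and> Q ((fst s)(r := snd s k (fst s a)), snd s)"
| "wp (Put k a r) Q s \<longleftrightarrow> 1 \<le> k \<and> k \<le> 15 \<and> 0 \<le> fst s a \<and>
    Q (fst s, heap_upd (snd s) k (fst s a) (fst s r))"
| "wp (c ;; d) Q s \<longleftrightarrow> wp c (wp d Q) s"
| "wp (Ifpos r c d) Q s \<longleftrightarrow> (if fst s r > 0 then wp c Q s else wp d Q s)"
| "wp (While r c) Q s \<longleftrightarrow> False"

lemma wp_mono: "wp c Q s \<Longrightarrow> (\<And>s. Q s \<Longrightarrow> Q' s) \<Longrightarrow> wp c Q' s"
proof (induction c arbitrary: Q Q' s)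
  case (Seq c d)
  then show ?case by (metis wp.simps(6))
qed (auto split: if_splits)

lemma wp_SeqI: "wp c Q' s \<Longrightarrow> (\<And>s'. Q' s' \<Longrightarrow> wp d Q s') \<Longrightarrow> wp (c ;; d) Q s"
  using wp_mono[of c Q' s "wp d Q"] by simp

lemma wp_terminates: "wp c Q s \<Longrightarrow> terminates c s (csize c) Q"
proof (induction c arbitrary: Q s)
  case (Seq c d)
  have "terminates c s (csize c) (wp d Q)" using Seq by simp
  then obtain t s' where 1: "t \<le> csize c" "exec c s t s'" "wp d Q s'"
    unfolding terminates_def by blast
  obtain t' s'' where 2: "t' \<le> csize d" "exec d s' t' s''" "Q s''"
    using Seq.IH(2)[OF 1(3)] unfolding terminates_def by blast
  have "t + t' \<le> csize (c ;; d)" using 1(1) 2(1) by simp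
  then show ?case unfolding terminates_def using exec.Seq[OF 1(2) 2(2)] 2(3) by blast
next
  case (Ifpos r c d)
  show ?case
  proof (cases "fst s r > 0")
    case True
    then have "wp c Q s" using Ifpos.prems by simp
    from Ifpos.IH(1)[OF this] obtain t s' where "t \<le> csize c" "exec c s t s'" "Q s'"
      unfolding terminates_def by blast
    then show ?thesis using exec.IfT[OF True, of c t s' d]
      unfolding terminates_def by (intro exI[of _ "t + 1"] exI[of _ s']) simp
  next
    case False
    then have "wp d Q s" using Ifpos.prems by simp
    from Ifpos.IH(2)[OF this] obtain t s' where "t \<le> csize d" "exec d s t s'" "Q s'"
      unfolding terminates_def by blast
    then show ?thesis using exec.IfF[OF False, of d t s' c]
      unfolding terminates_def by (intro exI[of _ "t + 1"] exI[of _ s']) simp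
  qed
next
  case (Const r c)
  then show ?case using exec.Const[of r c "fst s" "snd s"] by (auto simp: terminates_def)
next
  case (Plus r a b)
  then show ?case using exec.Plus[of r a b "fst s" "snd s"] by (auto simp: terminates_def)
next
  case (Minus r a b)
  then show ?case using exec.Minus[of r a b "fst s" "snd s"] by (auto simp: terminates_def)
next
  case (Fetch r k a)
  then show ?case using exec.Fetch[of k "fst s" a r "snd s"]
    unfolding terminates_def by (intro exI[of _ 1] exI) auto
next
  case (Put k a r)
  then show ?case using exec.Put[of k "fst s" a r "snd s"]
    unfolding terminates_def by (intro exI[of _ 1] exI) auto
qed simp

lemma terminates_mono:
  "terminates c s b Q \<Longrightarrow> (\<And>s. Q s \<Longrightarrow> Q' s) \<Longrightarrow> terminates c s b Q'"
  unfolding terminates_def by blast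

lemma terminates_Seq:
  assumes "terminates c s b Q" "\<And>s'. Q s' \<Longrightarrow> terminates d s' b' Q'"
  shows "terminates (c ;; d) s (b + b') Q'"
proof -
  obtain t s' where 1: "t \<le> b" "exec c s t s'" "Q s'" using assms(1) by (auto simp: terminates_def)
  obtain t' s'' where 2: "t' \<le> b'" "exec d s' t' s''" "Q' s''"
    using assms(2)[OF 1(3)] by (auto simp: terminates_def)
  show ?thesis unfolding terminates_def
    using exec.Seq[OF 1(2) 2(2)] 1(1) 2(1,3) add_mono by blast
qed

text \<open>A loop-free body costs at most \<open>csize c\<close> per round plus one for the test,
  and the measure bounds the number of rounds. As the measure may be global, amortised bounds need
  no nested loops.\<close>

lemma terminates_While:
  fixes \<mu> :: "store \<Rightarrow> nat"
  assumes "I s" "\<mu> s \<le> m"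
    and body: "\<And>s. I s \<Longrightarrow> fst s r > 0 \<Longrightarrow> wp c (\<lambda>s'. I s' \<and> \<mu> s' < \<mu> s) s"
  shows "terminates (While r c) s (m * (csize c + 1) + 1) (\<lambda>s'. I s' \<and> \<not> fst s' r > 0)"
  using assms(1,2)
proof (induction m arbitrary: s rule: less_induct)
  case (less m)
  show ?case
  proof (cases "fst s r > 0")
    case True
    obtain t s' where 1: "t \<le> csize c" "exec c s t s'" "I s'" "\<mu> s' < \<mu> s"
      using wp_terminates[OF body[OF less.prems(1) True]] by (auto simp: terminates_def)
    have "\<mu> s' \<le> m - 1" "m - 1 < m" using 1(4) less.prems(2) by linarith+
    from less.IH[OF this(2) 1(3) this(1)] obtain t' s'' where
      2: "t' \<le> (m - 1) * (csize c + 1) + 1" "exec (While r c) s' t' s''" "I s''" "\<not> fst s'' r > 0"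
      by (auto simp: terminates_def)
    have "t + t' + 1 \<le> (m - 1) * (csize c + 1) + 1 + (csize c + 1)" using 1(1) 2(1) by linarith
    also have "\<dots> = m * (csize c + 1) + 1" using \<open>m - 1 < m\<close> by (cases m) auto
    finally show ?thesis unfolding terminates_def
      using exec.WhileT[OF True 1(2) 2(2)] 2(3,4) by blast
  next
    case False
    then show ?thesis unfolding terminates_def
      using exec.WhileF less.prems(1) by (intro exI[of _ 1] exI[of _ s]) auto
  qed
qed

section \<open>Moving the input out of the way\<close>

text \<open>The targets -15, -31, -47 and -63 are entries 0 to 3 of array 15. The parameter
  \<open>b\<close> is the bit known from the branch, put back into cell 4 at the end.\<close>

definition save_header :: "int \<Rightarrow> instr list" where
  "save_header b = [LoadConst 4 (-15), StoreInd 4 0, LoadConst 4 (-31), StoreInd 4 1,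
     LoadConst 4 (-47), StoreInd 4 2, LoadConst 4 (-63), StoreInd 4 3, LoadConst 4 b]"

text \<open>Every directly addressable cell belongs to the input, but cell 4 holds the bit of node 0:
  after branching on it, cell 4 can serve as a pointer and be restored. The final loop copies input
  cell \<open>a\<close> to entry \<open>a\<close> of array 15, from the last cell down to cell 4.\<close>

definition prologue :: "instr list" where
  "prologue = [Jz 4 11] @ save_header 1 @ [Jpos 4 20] @ save_header 0 @
    [Add 0 0 1, Add 0 0 0, Add 0 0 3, LoadConst 3 3, Add 0 0 3,
     LoadConst 1 0, Sub 1 1 0, Add 1 1 1, Add 1 1 1, Add 1 1 1, Add 1 1 1,
     LoadConst 2 (-15), Add 1 1 2, LoadConst 3 1,
     LoadInd 2 0, StoreInd 1 2, Sub 0 0 3, LoadConst 2 16, Add 1 1 2,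
     LoadConst 2 3, Sub 2 0 2, Jpos 2 34]"

lemma length_prologue: "length prologue = 42"
  by (simp add: prologue_def save_header_def)

definition header_saved :: "(int \<Rightarrow> int) \<Rightarrow> int \<Rightarrow> int" where
  "header_saved M = M(-15 := M 0, -31 := M 1, -47 := M 2, -63 := M 3)"

lemma run_header:
  assumes "M 4 = 0 \<or> M 4 = 1"
  shows "\<exists>j \<le> 11. ram_run (prologue @ Q) j (0, M) = (20, header_saved M)"
proof -
  let ?P = "prologue @ Q"
  note step = ram_run_Suc ram_step_def ram_halted_def length_prologue nth_append prologue_def
    save_header_def header_saved_def
  from assms show ?thesis
  proof
    assume "M 4 = 0"
    then have "ram_run ?P 10 (0, M) = (20, header_saved M)"
      by (simp add: step eval_nat_numeral fun_eq_iff)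
    then show ?thesis by (intro exI[of _ 10]) simp
  next
    assume "M 4 = 1"
    then have "ram_run ?P 11 (0, M) = (20, header_saved M)"
      by (simp add: step eval_nat_numeral fun_eq_iff)
    then show ?thesis by (intro exI[of _ 11]) simp
  qed
qed

text \<open>The scan overwrites only cells 0 to 3 and negative cells, so the part of the input still
  to be copied stays intact. Entries above \<open>a\<close> include those past the end of the input,
  where source and target are both zero from the start.\<close>

definition copy_inv :: "(int \<Rightarrow> int) \<Rightarrow> int \<Rightarrow> (int \<Rightarrow> int) \<Rightarrow> bool" where
  "copy_inv I a M \<longleftrightarrow> M 0 = a \<and> M 1 = -16 * a - 15 \<and> M 3 = 1 \<and> (\<forall>b \<ge> 4. M b = I b) \<and>
    (\<forall>z \<ge> 0. z \<le> 3 \<or> a < z \<longrightarrow> M (-16 * z - 15) = I z) \<and>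
    (\<forall>z k. 0 \<le> z \<and> 1 \<le> k \<and> k \<le> 14 \<longrightarrow> M (-16 * z - int k) = 0)"

lemma run_copy_step:
  assumes "copy_inv I a M" "4 \<le> a"
  shows "\<exists>M'. ram_run (prologue @ Q) 8 (34, M) = (if a = 4 then 42 else 34, M') \<and> copy_inv I (a - 1) M'"
proof -
  let ?M = "M(-16 * a - 15 := I a, 0 := a - 1, 1 := -16 * (a - 1) - 15, 2 := a - 4)"
  note step = ram_run_Suc ram_step_def ram_halted_def length_prologue nth_append prologue_def
    save_header_def
  have M: "M 0 = a" "M 1 = -16 * a - 15" "M 3 = 1" "M a = I a"
    using assms by (auto simp: copy_inv_def)
  have "ram_run (prologue @ Q) 8 (34, M) = (if a = 4 then 42 else 34, ?M)"
    using assms(2) M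
    by (simp add: step eval_nat_numeral fun_eq_iff)
  moreover have "copy_inv I (a - 1) ?M"
    unfolding copy_inv_def
  proof (intro conjI allI impI)
    fix z :: int assume "0 \<le> z" "z \<le> 3 \<or> a - 1 < z"
    then show "?M (-16 * z - 15) = I z" using assms by (auto simp: copy_inv_def)
  next
    fix z :: int and k :: nat assume k: "0 \<le> z \<and> 1 \<le> k \<and> k \<le> 14"
    have "-16 * z - int k \<noteq> -16 * a - int 15" using k heap_address_eq[of k 15 z a] by simp
    then show "?M (-16 * z - int k) = 0" using k assms by (auto simp: copy_inv_def)
  qed (use assms in \<open>auto simp: copy_inv_def\<close>)
  ultimately show ?thesis by blast
qed

lemma run_copy:
  assumes "copy_inv I (int d + 4) M"
  shows "\<exists>M'. ram_run (prologue @ Q) (8 * (d + 1)) (34, M) = (42, M') \<and> copy_inv I 3 M'"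
  using assms
proof (induction d arbitrary: M)
  case 0
  then show ?case using run_copy_step[of I 4 M Q] by simp
next
  case (Suc d)
  from run_copy_step[OF Suc.prems, of Q] obtain M' where
    "ram_run (prologue @ Q) 8 (34, M) = (34, M')" "copy_inv I (int d + 4) M'" by (auto simp: add.commute)
  with Suc.IH[of M'] ram_run_add[of "prologue @ Q" 8 "8 * (d + 1)"] show ?case by auto
qed

text \<open>At most eleven steps save the header, fourteen set up the pointers, and eight copy each
  cell. The registers are existential because they hold leftovers of the input.\<close>

lemma run_prologue:
  assumes I: "I = input_mem n lab es v xs" and n: "0 < n"
  shows "\<exists>j M R H. j \<le> 8 * (2 * n + 2 * length es + length xs) + 25 \<and>
    ram_run (prologue @ Q) j (0, I) = (42, M) \<and> simulates M (R, H) \<and>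
    (\<forall>z \<ge> 0. H 15 z = I z) \<and> (\<forall>k z. 1 \<le> k \<and> k \<le> 14 \<and> 0 \<le> z \<longrightarrow> H k z = 0)"
proof -
  let ?P = "prologue @ Q"
  let ?a = "2 * int n + 2 * int (length es) + int (length xs) + 3"
  let ?h = "header_saved I"
  let ?M = "?h(0 := ?a, 1 := -16 * ?a - 15, 2 := -15, 3 := 1)"
  have I03: "I 0 = int n" "I 1 = int (length es)" "I 2 = int v" "I 3 = int (length xs)"
    by (simp_all add: I input_mem_def)
  have I4: "I 4 = 0 \<or> I 4 = 1" using n by (simp add: I input_mem_def)
  have I0: "I b = 0" if "b < 0 \<or> ?a < b" for b
  proof -
    have "b \<noteq> 0" "b \<noteq> 1" "b \<noteq> 2" "b \<noteq> 3" "\<not> (4 \<le> b \<and> b < 4 + 2 * int n)"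
      "\<not> (4 + 2 * int n \<le> b \<and> b < 4 + 2 * int n + 2 * int (length es))"
      "\<not> (4 + 2 * int n + 2 * int (length es) \<le> b \<and> b < 4 + 2 * int n + 2 * int (length es) + int (length xs))"
      using that by auto
    then show ?thesis unfolding I input_mem_def Let_def by (simp only: if_False)
  qed
  obtain i where i: "i \<le> 11" "ram_run ?P i (0, I) = (20, ?h)" using run_header[of I Q] I4 by blast
  have h: "?h 0 = int n" "?h 1 = int (length es)" "?h 3 = int (length xs)"
    using I03 by (auto simp: header_saved_def)
  note step = ram_run_Suc ram_step_def ram_halted_def length_prologue nth_append prologue_def
    save_header_def
  have m: "ram_run ?P 14 (20, ?h) = (34, ?M)"
    using h by (simp add: step eval_nat_numeral fun_eq_iff)
  have "copy_inv I ?a ?M"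
    unfolding copy_inv_def
  proof (intro conjI allI impI)
    fix z :: int assume z: "0 \<le> z" "z \<le> 3 \<or> ?a < z"
    then consider "z = 0" | "z = 1" | "z = 2" | "z = 3" | "?a < z" "3 < z" by linarith
    then show "?M (-16 * z - 15) = I z"
      by cases (use I03 I0[of z] I0[of "-16 * z - 15"] in \<open>auto simp: header_saved_def\<close>)
  next
    fix z :: int and k :: nat assume k: "0 \<le> z \<and> 1 \<le> k \<and> k \<le> 14"
    have "-16 * z - int k \<noteq> -16 * z' - int 15" for z' using k heap_address_eq[of k 15 z z'] by simp
    from this[of 0] this[of 1] this[of 2] this[of 3]
    show "?M (-16 * z - int k) = 0" using k I0[of "-16 * z - int k"] by (auto simp: header_saved_def)
  qed (use n in \<open>auto simp: header_saved_def\<close>)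
  \<comment> \<open>The copy loop tests at its end and so runs at least once; \<open>0 < n\<close>
    guarantees a cell to copy.\<close>
  moreover have "?a = int (2 * n + 2 * length es + length xs - 1) + 4" using n by simp
  ultimately obtain M where M: "ram_run ?P (8 * (2 * n + 2 * length es + length xs - 1 + 1)) (34, ?M) = (42, M)"
    "copy_inv I 3 M" using run_copy by metis
  let ?d = "2 * n + 2 * length es + length xs"
  have d: "?d - 1 + 1 = ?d" using n by simp
  have "ram_run ?P (i + (14 + 8 * ?d)) (0, I) = (42, M)"
    using M(1) unfolding d by (simp only: ram_run_add i(2) m)
  moreover have "simulates M (\<lambda>r. M (int r + 2), \<lambda>k z. M (-16 * z - int k))"
    by (simp add: simulates_def)
  moreover have "\<forall>z \<ge> 0. M (-16 * z - int 15) = I z" "\<forall>k z. 1 \<le> k \<and> k \<le> 14 \<and> 0 \<le> z \<longrightarrow> M (-16 * z - int k) = 0"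
    using M(2) by (auto simp: copy_inv_def)
  ultimately show ?thesis using i(1)
    by (intro exI[of _ "i + (14 + 8 * ?d)"] exI[of _ M] exI[of _ "\<lambda>r. M (int r + 2)"]
        exI[of _ "\<lambda>k z. M (-16 * z - int k)"]) auto
qed

section \<open>The search program\<close>

text \<open>Vertices are the nodes and one hub per element. A vertex is reached once it has both of its
  flags: for a node, flag 0 (array 5) means that it is the query node or adjacent to a reached node,
  and flag 1 (array 2) that its label agrees with the query set or that its element is covered.
  A hub gets flag 0 from the reached nodes carrying its element and has flag 1 from the start.\<close>

definition node :: "nat \<Rightarrow> int" where
  "node u = 2 * int u + 2"

text \<open>Parity separates nodes from hubs without any bound on the elements. The offsets 2 and 3
  let one constant serve both codes in \<open>node_body\<close>: \<open>2 * x + 3\<close> for the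
  hub, and the input address \<open>5 + 2 * i\<close> minus 3 for the node.\<close>

definition hub :: "nat \<Rightarrow> int" where
  "hub x = 2 * int x + 3"

lemma node_hub [simp]:
  "node u = node w \<longleftrightarrow> u = w" "hub x = hub y \<longleftrightarrow> x = y" "node u \<noteq> hub x" "hub x \<noteq> node u"
  "0 \<le> node u" "0 \<le> hub x"
  unfolding node_def hub_def by presburger+

text \<open>Arc \<open>a\<close> has its source in array 10, the index of the flag it sets in array 9, its target in
  array 8, and the previous arc with the same source in array 7. Array 3 holds the last arc of each
  source.\<close>

definition emit :: "nat \<Rightarrow> nat \<Rightarrow> nat \<Rightarrow> com" where
  "emit s t k = Plus 8 8 0 ;; Fetch 11 3 s ;; Put 7 8 11 ;; Put 3 s 8 ;; Put 8 8 t ;; Put 9 8 k ;; Put 10 8 s"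

definition is_prev :: "(int \<Rightarrow> int) \<Rightarrow> int \<Rightarrow> int \<Rightarrow> int \<Rightarrow> bool" where
  "is_prev src t a p \<longleftrightarrow> 0 \<le> p \<and> p \<le> a \<and> (0 < p \<longrightarrow> src p = t) \<and> (\<forall>b. p < b \<and> b \<le> a \<longrightarrow> src b \<noteq> t)"

definition arcs_ok :: "(nat \<Rightarrow> int \<Rightarrow> int) \<Rightarrow> int \<Rightarrow> bool" where
  "arcs_ok H N \<longleftrightarrow> 0 \<le> N \<and> (\<forall>t \<ge> 0. is_prev (H 10) t N (H 3 t)) \<and>
    (\<forall>a. 1 \<le> a \<and> a \<le> N \<longrightarrow> is_prev (H 10) (H 10 a) (a - 1) (H 7 a) \<and>
      0 \<le> H 8 a \<and> 0 \<le> H 10 a \<and> (H 9 a = 0 \<or> H 9 a = 1))"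

definition arc_set :: "(nat \<Rightarrow> int \<Rightarrow> int) \<Rightarrow> int \<Rightarrow> (int \<times> int \<times> int) set" where
  "arc_set H N = (\<lambda>a. (H 10 a, H 9 a, H 8 a)) ` {1..N}"

lemma is_prev_cong:
  "is_prev src t a p \<Longrightarrow> (\<And>b. b \<le> a \<Longrightarrow> src' b = src b) \<Longrightarrow> is_prev src' t a p"
  by (auto simp: is_prev_def)

lemma arc_set_append:
  assumes "0 \<le> N" "\<And>a. a \<le> N \<Longrightarrow> H' 8 a = H 8 a \<and> H' 9 a = H 9 a \<and> H' 10 a = H 10 a"
  shows "arc_set H' (N + 1) = insert (H' 10 (N + 1), H' 9 (N + 1), H' 8 (N + 1)) (arc_set H N)"
proof -
  have "{1..N + 1} = insert (N + 1) {1..N}" using assms(1) by auto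
  then show ?thesis using assms(2) by (auto simp: arc_set_def image_iff)
qed

definition emitted :: "nat \<Rightarrow> nat \<Rightarrow> nat \<Rightarrow> store \<Rightarrow> store \<Rightarrow> bool" where
  "emitted a b k s s' \<longleftrightarrow> arcs_ok (snd s') (fst s' 8) \<and>
    arc_set (snd s') (fst s' 8) = insert (fst s a, fst s k, fst s b) (arc_set (snd s) (fst s 8)) \<and>
    (\<forall>f. f \<notin> {3, 7, 8, 9, 10} \<longrightarrow> snd s' f = snd s f) \<and> fst s' 8 = fst s 8 + 1 \<and>
    (\<forall>r. r \<noteq> 8 \<and> r \<noteq> 11 \<longrightarrow> fst s' r = fst s r)"

text \<open>Only the list of the source gains an entry: its head becomes the new arc, linked to the
  old head. Sources of older arcs are not rewritten, so their links stay valid, and for every other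
  vertex the old head is still its last arc. Registers 8 and 11 are excluded as arguments because
  \<open>emit\<close> overwrites them.\<close>

lemma wp_emit:
  assumes ok: "arcs_ok (snd st) (fst st 8)"
    and nn: "0 \<le> fst st s" "0 \<le> fst st t" "fst st k = 0 \<or> fst st k = 1" and one: "fst st 0 = 1"
    and regs: "s \<noteq> 8" "s \<noteq> 11" "t \<noteq> 8" "t \<noteq> 11" "k \<noteq> 8" "k \<noteq> 11"
  shows "wp (emit s t k) (emitted s t k st) st"
proof -
  obtain R H where st: "st = (R, H)" by (cases st)
  note ok = ok[unfolded st fst_conv snd_conv] and nn = nn[unfolded st fst_conv snd_conv]
    and one = one[unfolded st fst_conv snd_conv]
  let ?N = "R 8 + 1"
  let ?R = "R(8 := ?N, 11 := H 3 (R s))"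
  let ?H = "heap_upd (heap_upd (heap_upd (heap_upd (heap_upd H 7 ?N (H 3 (R s))) 3 (R s) ?N) 8 ?N (R t)) 9 ?N (R k)) 10 ?N (R s)"
  have N: "0 \<le> R 8" using ok by (simp add: arcs_ok_def)
  have src: "?H 10 b = H 10 b" if "b \<le> R 8" for b using that by (simp add: heap_upd_apply)
  have prev: "is_prev (?H 10) t a p" if "is_prev (H 10) t a p" "a \<le> R 8" for t a p
    using that by (intro is_prev_cong[OF that(1)] src) simp
  have old: "is_prev (H 10) (H 10 a) (a - 1) (H 7 a) \<and> 0 \<le> H 8 a \<and> 0 \<le> H 10 a \<and> (H 9 a = 0 \<or> H 9 a = 1)"
    if "1 \<le> a" "a \<le> R 8" for a using ok that by (simp add: arcs_ok_def)
  have head: "is_prev (H 10) t (R 8) (H 3 t)" if "0 \<le> t" for t using ok that by (simp add: arcs_ok_def)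
  have head': "is_prev (?H 10) z (R 8) (H 3 z)" if "0 \<le> z" for z by (rule prev[OF head[OF that]]) simp
  have "arcs_ok ?H ?N"
    unfolding arcs_ok_def
  proof (intro conjI allI impI)
    fix z :: int assume z: "0 \<le> z"
    show "is_prev (?H 10) z ?N (?H 3 z)"
    proof (cases "z = R s")
      case True
      then show ?thesis using N by (simp add: is_prev_def heap_upd_apply)
    next
      case False
      have new: "?H 10 ?N = R s" "?H 3 z = H 3 z" using False by (simp_all add: heap_upd_apply)
      have "is_prev src z ?N p" if "is_prev src z (R 8) p" "src ?N \<noteq> z" for src p
        unfolding is_prev_def
      proof (intro conjI allI impI)
        fix b assume b: "p < b \<and> b \<le> ?N"
        show "src b \<noteq> z" using that b by (cases "b = ?N") (auto simp: is_prev_def)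
      qed (use that in \<open>auto simp: is_prev_def\<close>)
      from this[OF head'[OF z]] False show ?thesis unfolding new by simp
    qed
  next
    fix a :: int assume a: "1 \<le> a \<and> a \<le> ?N"
    show "is_prev (?H 10) (?H 10 a) (a - 1) (?H 7 a)"
    proof (cases "a = ?N")
      case True
      then show ?thesis using head'[OF nn(1)] by (simp add: heap_upd_apply)
    next
      case False
      then have "a \<le> R 8" using a by simp
      then show ?thesis using prev[of "H 10 a" "a - 1" "H 7 a"] old[of a] a by (simp add: heap_upd_apply)
    qed
    show "0 \<le> ?H 8 a" "0 \<le> ?H 10 a" "?H 9 a = 0 \<or> ?H 9 a = 1"
      using old[of a] a nn by (auto simp: heap_upd_apply)
  qed (use N in simp)
  moreover have "arc_set ?H ?N = insert (R s, R k, R t) (arc_set H (R 8))"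
    using arc_set_append[of "R 8" ?H H] N by (simp add: heap_upd_apply)
  moreover have "?H f = H f" if "f \<notin> {3, 7, 8, 9, 10}" for f using that by (simp add: heap_upd_other)
  ultimately have "emitted s t k st (?R, ?H)" unfolding emitted_def st fst_conv snd_conv by auto
  then show ?thesis using N nn one regs by (simp add: st emit_def heap_upd_other)
qed

section \<open>Building arcs and initial flags from the input\<close>

definition input_ok :: "nat \<Rightarrow> (nat \<Rightarrow> bool \<times> nat) \<Rightarrow> (nat \<times> nat) list \<Rightarrow> nat \<Rightarrow> nat list \<Rightarrow> (int \<Rightarrow> int) \<Rightarrow> bool" where
  "input_ok n lab es v xs I \<longleftrightarrow> (\<forall>z \<ge> 0. I z = input_mem n lab es v xs z)"

lemma input_okD:
  assumes "input_ok n lab es v xs I"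
  shows "I 0 = int n" "I 1 = int (length es)" "I 2 = int v" "I 3 = int (length xs)"
    and "i < n \<Longrightarrow> I (4 + 2 * int i) = of_bool (fst (lab i))"
    and "i < n \<Longrightarrow> I (5 + 2 * int i) = int (snd (lab i))"
    and "j < length es \<Longrightarrow> I (4 + 2 * int n + 2 * int j) = int (fst (es ! j))"
    and "j < length es \<Longrightarrow> I (5 + 2 * int n + 2 * int j) = int (snd (es ! j))"
    and "k < length xs \<Longrightarrow> I (4 + 2 * int n + 2 * int (length es) + int k) = int (xs ! k)"
proof -
  have 1: "(1 + 2 * int i) div 2 = int i" "(1 + 2 * int i) mod 2 = 1" for i by presburger+
  have I: "I z = input_mem n lab es v xs z" if "0 \<le> z" for z using assms that by (simp add: input_ok_def)
  show "I 0 = int n" "I 1 = int (length es)" "I 2 = int v" "I 3 = int (length xs)"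
    by (simp_all add: I input_mem_def)
  show "i < n \<Longrightarrow> I (4 + 2 * int i) = of_bool (fst (lab i))"
    by (simp add: I input_mem_def)
  show "i < n \<Longrightarrow> I (5 + 2 * int i) = int (snd (lab i))"
    by (simp add: I input_mem_def Let_def 1)
  show "j < length es \<Longrightarrow> I (4 + 2 * int n + 2 * int j) = int (fst (es ! j))"
    by (simp add: I input_mem_def Let_def)
  show "j < length es \<Longrightarrow> I (5 + 2 * int n + 2 * int j) = int (snd (es ! j))"
    by (simp add: I input_mem_def Let_def 1)
  show "k < length xs \<Longrightarrow> I (4 + 2 * int n + 2 * int (length es) + int k) = int (xs ! k)"
    by (simp add: I input_mem_def Let_def)
qed

text \<open>Register 0 is the constant 1, registers 1 to 3 hold \<open>n\<close>, \<open>m\<close>, \<open>v\<close>, and registers 13 and 14 are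
  the constants 2 and 0.\<close>

definition regs_ok :: "nat \<Rightarrow> nat \<Rightarrow> nat \<Rightarrow> (nat \<Rightarrow> int) \<Rightarrow> bool" where
  "regs_ok n m v R \<longleftrightarrow> R 0 = 1 \<and> R 1 = int n \<and> R 2 = int m \<and> R 3 = int v \<and> R 13 = 2 \<and> R 14 = 0"

definition load_header :: com where
  "load_header = Const 0 1 ;; Const 13 2 ;; Const 14 0 ;; Const 8 0 ;; Const 9 0 ;;
    Fetch 1 15 9 ;; Plus 9 9 0 ;; Fetch 2 15 9 ;; Plus 9 9 0 ;; Fetch 3 15 9 ;; Plus 9 9 0 ;;
    Fetch 4 15 9 ;; Plus 9 9 0 ;; Plus 9 9 0 ;; Minus 9 9 0 ;;
    Plus 5 1 2 ;; Plus 5 5 5 ;; Plus 5 5 9"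

definition mark_body :: com where
  "mark_body = Fetch 6 15 5 ;; Put 6 6 0 ;; Plus 5 5 0 ;; Minus 4 4 0"

text \<open>Only positivity can be tested, so agreement, the equality of label bit and membership
  bit, takes a test of their difference and one of its negation. \<open>Const 12 0\<close> acts as a
  skip.\<close>

definition node_body :: com where
  "node_body =
    (Fetch 6 15 5 ;; Plus 5 5 0 ;; Fetch 7 15 5 ;; Fetch 9 6 7 ;; Minus 9 6 9 ;;
     Plus 7 7 7 ;; Const 10 3 ;; Plus 7 7 10 ;; Minus 6 5 10 ;; Put 2 7 0 ;;
     Ifpos 9 (Const 12 0) (Minus 9 14 9 ;; Ifpos 9 (Const 12 0) (Put 2 6 0))) ;;
    emit 6 7 14 ;; emit 7 6 0 ;; Plus 5 5 0 ;; Minus 4 4 0"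

definition edge_body :: com where
  "edge_body =
    (Fetch 6 15 5 ;; Plus 5 5 0 ;; Fetch 7 15 5 ;; Plus 5 5 0 ;;
     Plus 6 6 6 ;; Plus 6 6 13 ;; Plus 7 7 7 ;; Plus 7 7 13) ;;
    emit 6 7 14 ;; emit 7 6 14 ;; Minus 4 4 0"

text \<open>Rule \<open>seen\<close> relates all pairs of nodes with a common element, possibly
  quadratically many; routing them through the hub leaves two arcs per node.\<close>

definition node_arcs :: "(nat \<Rightarrow> bool \<times> nat) \<Rightarrow> nat \<Rightarrow> (int \<times> int \<times> int) set" where
  "node_arcs lab i = (\<Union>u<i. {(node u, 0, hub (snd (lab u))), (hub (snd (lab u)), 1, node u)})"

definition edge_arcs :: "(nat \<times> nat) list \<Rightarrow> (int \<times> int \<times> int) set" where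
  "edge_arcs es = (\<Union>(u, w)\<in>set es. {(node u, 0, node w), (node w, 0, node u)})"

definition preset :: "(nat \<Rightarrow> bool \<times> nat) \<Rightarrow> nat set \<Rightarrow> nat \<Rightarrow> int set" where
  "preset lab X i = {z. \<exists>u<i. z = hub (snd (lab u)) \<or> (agrees lab X u \<and> z = node u)}"

definition blank :: "(nat \<Rightarrow> int \<Rightarrow> int) \<Rightarrow> bool" where
  "blank H \<longleftrightarrow> (\<forall>z \<ge> 0. H 5 z = 0 \<and> H 2 z = 0 \<and> H 3 z = 0)"

lemma mark_loop:
  assumes "input_ok n lab es v xs (H 15)" "regs_ok n (length es) v R"
    and "R 4 = int (length xs)" "R 5 = 4 + 2 * int n + 2 * int (length es)"
    and "\<forall>z \<ge> 0. H 6 z = 0" "blank H" "R 8 = 0"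
  shows "terminates (While 4 mark_body) (R, H) (length xs * (csize mark_body + 1) + 1)
    (\<lambda>(R, H). input_ok n lab es v xs (H 15) \<and> regs_ok n (length es) v R \<and>
      (\<forall>z \<ge> 0. H 6 z = of_bool (z \<in> int ` set xs)) \<and> blank H \<and> R 8 = 0)"
proof -
  let ?I = "\<lambda>(R, H). \<exists>k \<le> length xs. R 4 = int (length xs) - int k \<and>
      R 5 = 4 + 2 * int n + 2 * int (length es) + int k \<and>
      input_ok n lab es v xs (H 15) \<and> regs_ok n (length es) v R \<and>
      (\<forall>z \<ge> 0. H 6 z = of_bool (z \<in> int ` set (take k xs))) \<and> blank H \<and> R 8 = 0"
  have body: "wp mark_body (\<lambda>s'. ?I s' \<and> nat (fst s' 4) < nat (fst s 4)) s"
    if I: "?I s" and pos: "0 < fst s 4" for s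
  proof -
    obtain R H where s: "s = (R, H)" by (cases s)
    obtain k where k: "k \<le> length xs" "R 4 = int (length xs) - int k"
      "R 5 = 4 + 2 * int n + 2 * int (length es) + int k"
      "input_ok n lab es v xs (H 15)" "regs_ok n (length es) v R"
      "\<forall>z \<ge> 0. H 6 z = of_bool (z \<in> int ` set (take k xs))" "blank H" "R 8 = 0"
      using I by (auto simp: s)
    have kl: "k < length xs" using pos k(2) by (simp add: s)
    let ?H = "heap_upd H 6 (int (xs ! k)) 1"
    let ?R = "R(6 := int (xs ! k), 5 := R 5 + 1, 4 := R 4 - 1)"
    have take: "set (take (Suc k) xs) = insert (xs ! k) (set (take k xs))"
      using kl by (simp add: take_Suc_conv_app_nth)
    have m: "\<forall>z \<ge> 0. ?H 6 z = of_bool (z \<in> int ` set (take (Suc k) xs))"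
      using k(6) by (auto simp: heap_upd_apply take)
    have "?I (?R, ?H)"
      using k kl m by (auto simp: regs_ok_def blank_def heap_upd_other intro!: exI[of _ "Suc k"])
    then show ?thesis
      using k(3,5) pos input_okD(9)[OF k(4) kl]
      by (simp add: s mark_body_def regs_ok_def)
  qed
  have "?I (R, H)" using assms by (auto intro!: exI[of _ 0])
  from terminates_While[of ?I "(R, H)" "\<lambda>s. nat (fst s 4)" "length xs" 4 mark_body, OF this _ body]
  have "terminates (While 4 mark_body) (R, H) (length xs * (csize mark_body + 1) + 1)
    (\<lambda>s'. ?I s' \<and> \<not> 0 < fst s' 4)" using assms(3) by simp
  then show ?thesis
    by (rule terminates_mono) auto
qed

lemma node_arcs_Suc:
  "node_arcs lab (Suc i) =
    insert (hub (snd (lab i)), 1, node i) (insert (node i, 0, hub (snd (lab i))) (node_arcs lab i))"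
  by (auto simp: node_arcs_def lessThan_Suc)

lemma preset_Suc:
  "z \<in> preset lab X (Suc i) \<longleftrightarrow> z \<in> preset lab X i \<or> z = hub (snd (lab i)) \<or> (agrees lab X i \<and> z = node i)"
  by (auto simp: preset_def less_Suc_eq)

lemma edge_arcs_take_Suc:
  "j < length es \<Longrightarrow> edge_arcs (take (Suc j) es) =
    insert (node (snd (es ! j)), 0, node (fst (es ! j)))
      (insert (node (fst (es ! j)), 0, node (snd (es ! j))) (edge_arcs (take j es)))"
  by (auto simp: edge_arcs_def take_Suc_conv_app_nth split: prod.splits)

definition node_inv :: "nat \<Rightarrow> (nat \<Rightarrow> bool \<times> nat) \<Rightarrow> (nat \<times> nat) list \<Rightarrow> nat \<Rightarrow> nat list \<Rightarrow> nat \<Rightarrow> store \<Rightarrow> bool" where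
  "node_inv n lab es v xs i s \<longleftrightarrow>
    input_ok n lab es v xs (snd s 15) \<and> regs_ok n (length es) v (fst s) \<and>
    fst s 4 = int n - int i \<and> fst s 5 = 4 + 2 * int i \<and>
    (\<forall>z \<ge> 0. snd s 6 z = of_bool (z \<in> int ` set xs)) \<and> (\<forall>z \<ge> 0. snd s 5 z = 0) \<and>
    (\<forall>z \<ge> 0. snd s 2 z = of_bool (z \<in> preset lab (set xs) i)) \<and>
    fst s 8 = 2 * int i \<and> arcs_ok (snd s) (fst s 8) \<and> arc_set (snd s) (fst s 8) = node_arcs lab i"

lemma node_body_correct:
  assumes inv: "node_inv n lab es v xs i s" and i: "i < n"
  shows "wp node_body (node_inv n lab es v xs (Suc i)) s"
proof -
  let ?x = "snd (lab i)"
  let ?A = "\<lambda>s'. (\<forall>r. r \<in> {0, 1, 2, 3, 4, 8, 13, 14} \<longrightarrow> fst s' r = fst s r) \<and>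
    fst s' 5 = 5 + 2 * int i \<and> fst s' 6 = node i \<and> fst s' 7 = hub ?x \<and>
    (\<forall>f. f \<noteq> 2 \<longrightarrow> snd s' f = snd s f) \<and>
    (\<forall>z \<ge> 0. snd s' 2 z = of_bool (z \<in> preset lab (set xs) (Suc i)))"
  note inv' = inv[unfolded node_inv_def]
  have regs: "fst s 0 = 1" "fst s 14 = 0" "fst s 5 = 4 + 2 * int i" using inv' by (auto simp: regs_ok_def)
  have inp: "snd s 15 (4 + 2 * int i) = of_bool (fst (lab i))" "snd s 15 (5 + 2 * int i) = int ?x"
    using inv' input_okD(5,6) i by blast+
  have X: "snd s 6 (int ?x) = of_bool (?x \<in> set xs)" using inv' by auto
  have agr: "agrees lab (set xs) i \<longleftrightarrow> fst (lab i) = (?x \<in> set xs)" by (simp add: agrees_def)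
  have p5: "4 + 2 * int i + 1 = 5 + 2 * int i" "5 + 2 * int i - 3 = node i" "2 * int ?x + 3 = hub ?x"
    by (auto simp: node_def hub_def)
  have S: "snd s 2 z = of_bool (z \<in> preset lab (set xs) i)" if "0 \<le> z" for z using inv' that by blast
  have "wp (Fetch 6 15 5 ;; Plus 5 5 0 ;; Fetch 7 15 5 ;; Fetch 9 6 7 ;; Minus 9 6 9 ;;
     Plus 7 7 7 ;; Const 10 3 ;; Plus 7 7 10 ;; Minus 6 5 10 ;; Put 2 7 0 ;;
     Ifpos 9 (Const 12 0) (Minus 9 14 9 ;; Ifpos 9 (Const 12 0) (Put 2 6 0))) ?A s"
    by (cases "fst (lab i)"; cases "?x \<in> set xs")
      (simp_all add: regs inp X p5 heap_upd_other heap_upd_apply preset_Suc agr S)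
  then show ?thesis unfolding node_body_def
  proof (rule wp_SeqI)
    fix s1 assume A: "?A s1"
    then have r1: "fst s1 0 = 1" "fst s1 14 = 0" "fst s1 6 = node i" "fst s1 7 = hub ?x" "fst s1 8 = fst s 8"
      using regs by auto
    have f1: "snd s1 f = snd s f" if "f \<noteq> 2" for f using A that by blast
    have a1: "arcs_ok (snd s1) (fst s1 8)" "arc_set (snd s1) (fst s1 8) = node_arcs lab i"
      using inv' by (auto simp: arcs_ok_def arc_set_def f1 r1)
    show "wp (emit 6 7 14 ;; emit 7 6 0 ;; Plus 5 5 0 ;; Minus 4 4 0) (node_inv n lab es v xs (Suc i)) s1"
    proof (rule wp_SeqI[OF wp_emit])
      fix s2 assume s2: "emitted 6 7 14 s1 s2"
      have r2: "fst s2 0 = 1" "fst s2 6 = node i" "fst s2 7 = hub ?x" using s2 r1 by (auto simp: emitted_def)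
      show "wp (emit 7 6 0 ;; Plus 5 5 0 ;; Minus 4 4 0) (node_inv n lab es v xs (Suc i)) s2"
      proof (rule wp_SeqI[OF wp_emit])
        fix s3 assume s3: "emitted 7 6 0 s2 s3"
        have f3: "snd s3 f = snd s f" if "f \<notin> {2, 3, 7, 8, 9, 10}" for f
          using s2 s3 f1[of f] that by (auto simp: emitted_def)
        have f2: "snd s3 2 = snd s1 2" using s2 s3 by (simp add: emitted_def)
        have r3: "fst s3 r = fst s1 r" if "r \<noteq> 8" "r \<noteq> 11" for r
          using s2 s3 that by (simp add: emitted_def)
        have arcs2: "arc_set (snd s2) (fst s2 8) = insert (fst s1 6, fst s1 14, fst s1 7) (arc_set (snd s1) (fst s1 8))"
          using s2 unfolding emitted_def by blast
        have arcs3: "arc_set (snd s3) (fst s3 8) = insert (fst s2 7, fst s2 0, fst s2 6) (arc_set (snd s2) (fst s2 8))"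
          using s3 unfolding emitted_def by blast
        have "arc_set (snd s3) (fst s3 8) = node_arcs lab (Suc i)"
          by (simp only: arcs3 arcs2 a1 r1(1-4) r2 node_arcs_Suc)
        moreover have "fst s3 8 = 2 * int (Suc i)" using s3 s2 r1(5) inv' by (simp add: emitted_def)
        moreover have "arcs_ok (snd s3) (fst s3 8)" using s3 unfolding emitted_def by blast
        moreover have "regs_ok n (length es) v (fst s3)" using inv' A by (simp add: regs_ok_def r3)
        ultimately show "wp (Plus 5 5 0 ;; Minus 4 4 0) (node_inv n lab es v xs (Suc i)) s3" using inv' A
          by (simp add: node_inv_def f3 f2 r3 r1 regs_ok_def)
      qed (use s2 r2 in \<open>auto simp: emitted_def\<close>)
    qed (use a1 r1 in auto)
  qed
qed

lemma node_loop:
  assumes "node_inv n lab es v xs 0 s"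
  shows "terminates (While 4 node_body) s (n * (csize node_body + 1) + 1) (node_inv n lab es v xs n)"
proof -
  let ?I = "\<lambda>s. \<exists>i \<le> n. node_inv n lab es v xs i s"
  have reg4: "fst s 4 = int n - int i" if "node_inv n lab es v xs i s" for i s
    using that by (simp add: node_inv_def)
  have body: "wp node_body (\<lambda>s'. ?I s' \<and> nat (fst s' 4) < nat (fst s 4)) s"
    if I: "?I s" and pos: "0 < fst s 4" for s
  proof -
    obtain i where i: "node_inv n lab es v xs i s" using I by blast
    have "i < n" using reg4[OF i] pos by simp
    from node_body_correct[OF i this] show ?thesis
    proof (rule wp_mono)
      fix s' assume s': "node_inv n lab es v xs (Suc i) s'"
      have "?I s'" using s' Suc_leI[OF \<open>i < n\<close>] by blast
      then show "?I s' \<and> nat (fst s' 4) < nat (fst s 4)"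
        using reg4[OF s'] reg4[OF i] \<open>i < n\<close> by simp
    qed
  qed
  have "?I s" "nat (fst s 4) \<le> n" using assms reg4[OF assms] by auto
  from terminates_While[of ?I s "\<lambda>s. nat (fst s 4)" n 4 node_body, OF this body]
  show ?thesis
  proof (rule terminates_mono)
    fix s' assume "?I s' \<and> \<not> 0 < fst s' 4"
    then obtain i where i: "i \<le> n" "node_inv n lab es v xs i s'" "\<not> 0 < fst s' 4" by blast
    then have "i = n" using reg4[OF i(2)] by simp
    then show "node_inv n lab es v xs n s'" using i(2) by simp
  qed
qed

definition edge_inv :: "nat \<Rightarrow> (nat \<Rightarrow> bool \<times> nat) \<Rightarrow> (nat \<times> nat) list \<Rightarrow> nat \<Rightarrow> nat list \<Rightarrow> nat \<Rightarrow> store \<Rightarrow> bool" where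
  "edge_inv n lab es v xs j s \<longleftrightarrow>
    input_ok n lab es v xs (snd s 15) \<and> regs_ok n (length es) v (fst s) \<and>
    fst s 4 = int (length es) - int j \<and> fst s 5 = 4 + 2 * int n + 2 * int j \<and>
    (\<forall>z \<ge> 0. snd s 5 z = 0) \<and> (\<forall>z \<ge> 0. snd s 2 z = of_bool (z \<in> preset lab (set xs) n)) \<and>
    fst s 8 = 2 * int n + 2 * int j \<and> arcs_ok (snd s) (fst s 8) \<and>
    arc_set (snd s) (fst s 8) = node_arcs lab n \<union> edge_arcs (take j es)"

lemma edge_body_correct:
  assumes inv: "edge_inv n lab es v xs j s" and j: "j < length es"
  shows "wp edge_body (edge_inv n lab es v xs (Suc j)) s"
proof -
  obtain u w where uw: "es ! j = (u, w)" by (cases "es ! j")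
  let ?A = "\<lambda>s'. (\<forall>r. r \<in> {0, 1, 2, 3, 4, 8, 13, 14} \<longrightarrow> fst s' r = fst s r) \<and>
    fst s' 5 = 6 + 2 * int n + 2 * int j \<and> fst s' 6 = node u \<and> fst s' 7 = node w \<and> snd s' = snd s"
  note inv' = inv[unfolded edge_inv_def]
  have regs: "fst s 0 = 1" "fst s 13 = 2" "fst s 14 = 0" "fst s 5 = 4 + 2 * int n + 2 * int j"
    using inv' by (auto simp: regs_ok_def)
  have inp: "snd s 15 (4 + 2 * int n + 2 * int j) = int u" "snd s 15 (5 + 2 * int n + 2 * int j) = int w"
    using inv' input_okD(7,8)[of n lab es v xs "snd s 15" j] j uw by auto
  have p5: "4 + 2 * int n + 2 * int j + 1 = 5 + 2 * int n + 2 * int j"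
    "5 + 2 * int n + 2 * int j + 1 = 6 + 2 * int n + 2 * int j" by auto
  have "wp (Fetch 6 15 5 ;; Plus 5 5 0 ;; Fetch 7 15 5 ;; Plus 5 5 0 ;;
     Plus 6 6 6 ;; Plus 6 6 13 ;; Plus 7 7 7 ;; Plus 7 7 13) ?A s"
    by (simp add: regs inp p5 node_def)
  then show ?thesis unfolding edge_body_def
  proof (rule wp_SeqI)
    fix s1 assume A: "?A s1"
    then have r1: "fst s1 0 = 1" "fst s1 14 = 0" "fst s1 6 = node u" "fst s1 7 = node w" "fst s1 8 = fst s 8"
      using regs by auto
    have f1: "snd s1 = snd s" using A by blast
    have a1: "arcs_ok (snd s1) (fst s1 8)"
      "arc_set (snd s1) (fst s1 8) = node_arcs lab n \<union> edge_arcs (take j es)"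
      using inv' by (auto simp: f1 r1)
    show "wp (emit 6 7 14 ;; emit 7 6 14 ;; Minus 4 4 0) (edge_inv n lab es v xs (Suc j)) s1"
    proof (rule wp_SeqI[OF wp_emit])
      fix s2 assume s2: "emitted 6 7 14 s1 s2"
      have r2: "fst s2 0 = 1" "fst s2 6 = node u" "fst s2 7 = node w" "fst s2 14 = 0" using s2 r1 by (auto simp: emitted_def)
      show "wp (emit 7 6 14 ;; Minus 4 4 0) (edge_inv n lab es v xs (Suc j)) s2"
      proof (rule wp_SeqI[OF wp_emit])
        fix s3 assume s3: "emitted 7 6 14 s2 s3"
        have f3: "snd s3 f = snd s f" if "f \<notin> {3, 7, 8, 9, 10}" for f
          using s2 s3 f1 that by (auto simp: emitted_def)
        have r3: "fst s3 r = fst s1 r" if "r \<noteq> 8" "r \<noteq> 11" for r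
          using s2 s3 that by (simp add: emitted_def)
        have arcs2: "arc_set (snd s2) (fst s2 8) = insert (fst s1 6, fst s1 14, fst s1 7) (arc_set (snd s1) (fst s1 8))"
          using s2 unfolding emitted_def by blast
        have arcs3: "arc_set (snd s3) (fst s3 8) = insert (fst s2 7, fst s2 14, fst s2 6) (arc_set (snd s2) (fst s2 8))"
          using s3 unfolding emitted_def by blast
        have "arc_set (snd s3) (fst s3 8) = node_arcs lab n \<union> edge_arcs (take (Suc j) es)"
          by (simp only: arcs3 arcs2 a1 r1(1-4) r2 edge_arcs_take_Suc[OF j] uw fst_conv snd_conv Un_insert_right)
        moreover have "fst s3 8 = 2 * int n + 2 * int (Suc j)" using s3 s2 r1(5) inv' by (simp add: emitted_def)
        moreover have "arcs_ok (snd s3) (fst s3 8)" using s3 unfolding emitted_def by blast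
        moreover have "regs_ok n (length es) v (fst s3)" using inv' A by (simp add: regs_ok_def r3)
        ultimately show "wp (Minus 4 4 0) (edge_inv n lab es v xs (Suc j)) s3" using inv' A
          by (simp add: edge_inv_def f3 r3 r1 regs_ok_def)
      qed (use s2 r2 in \<open>auto simp: emitted_def\<close>)
    qed (use a1 r1 in auto)
  qed
qed

lemma edge_loop:
  assumes "edge_inv n lab es v xs 0 s"
  shows "terminates (While 4 edge_body) s (length es * (csize edge_body + 1) + 1)
    (edge_inv n lab es v xs (length es))"
proof -
  let ?I = "\<lambda>s. \<exists>j \<le> length es. edge_inv n lab es v xs j s"
  have reg4: "fst s 4 = int (length es) - int j" if "edge_inv n lab es v xs j s" for j s
    using that by (simp add: edge_inv_def)
  have body: "wp edge_body (\<lambda>s'. ?I s' \<and> nat (fst s' 4) < nat (fst s 4)) s"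
    if I: "?I s" and pos: "0 < fst s 4" for s
  proof -
    obtain j where j: "edge_inv n lab es v xs j s" using I by blast
    have "j < length es" using reg4[OF j] pos by simp
    from edge_body_correct[OF j this] show ?thesis
    proof (rule wp_mono)
      fix s' assume s': "edge_inv n lab es v xs (Suc j) s'"
      have "?I s'" using s' Suc_leI[OF \<open>j < length es\<close>] by blast
      then show "?I s' \<and> nat (fst s' 4) < nat (fst s 4)"
        using reg4[OF s'] reg4[OF j] \<open>j < length es\<close> by simp
    qed
  qed
  have "?I s" "nat (fst s 4) \<le> length es" using assms reg4[OF assms] by auto
  from terminates_While[of ?I s "\<lambda>s. nat (fst s 4)" "length es" 4 edge_body, OF this body]
  show ?thesis
  proof (rule terminates_mono)
    fix s' assume "?I s' \<and> \<not> 0 < fst s' 4"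
    then obtain j where j: "j \<le> length es" "edge_inv n lab es v xs j s'" "\<not> 0 < fst s' 4" by blast
    then have "j = length es" using reg4[OF j(2)] by simp
    then show "edge_inv n lab es v xs (length es) s'" using j(2) by simp
  qed
qed

section \<open>Conjunctive search along the arcs\<close>

inductive flagged :: "(int \<times> int \<times> int) set \<Rightarrow> int set \<Rightarrow> int \<Rightarrow> int \<Rightarrow> int \<Rightarrow> bool"
  for A S d where
  query: "flagged A S d d 0"
| preset: "z \<in> S \<Longrightarrow> flagged A S d z 1"
| arc: "(s, k, t) \<in> A \<Longrightarrow> flagged A S d s 0 \<Longrightarrow> flagged A S d s 1 \<Longrightarrow> flagged A S d t k"

definition push :: com where
  "push = Plus 5 5 0 ;; Put 4 5 6"

text \<open>Register 10 keeps the old value of the flag being set and register 11 the other flag of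
  the target. A push happens only if the first was unset and the second is set, that is, at the
  moment the vertex becomes full, so no vertex is pushed twice.\<close>

definition arc_step :: com where
  "arc_step = Fetch 6 8 4 ;; Fetch 9 9 4 ;; Fetch 4 7 4 ;;
    Ifpos 9 (Fetch 10 2 6 ;; Put 2 6 0 ;; Fetch 11 5 6) (Fetch 10 5 6 ;; Put 5 6 0 ;; Fetch 11 2 6) ;;
    Ifpos 10 (Const 12 0) (Ifpos 11 push (Const 12 0))"

definition pop_step :: com where
  "pop_step = Fetch 7 4 5 ;; Minus 5 5 0 ;; Fetch 4 3 7"

text \<open>Register 4 is the next arc of the vertex in register 7, register 5 the height of the stack in
  array 4; register 15 is positive as long as one of them is.\<close>

definition search_body :: com where
  "search_body = Ifpos 4 arc_step pop_step ;; Plus 15 4 5"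

locale search =
  fixes G :: "nat \<Rightarrow> int \<Rightarrow> int" and N :: int and S :: "int set" and d :: int and n m v :: nat
  assumes ok: "arcs_ok G N" and S_nonneg: "\<And>z. z \<in> S \<Longrightarrow> 0 \<le> z" and d_nonneg: "0 \<le> d"
begin

abbreviation "src \<equiv> G 10"
abbreviation "knd \<equiv> G 9"
abbreviation "tgt \<equiv> G 8"

definition "fl = flagged (arc_set G N) S d"

text \<open>Only these vertices can ever have flag 0. There are at most \<open>N + 1\<close> of
  them, which bounds the number of pops although vertex codes are unbounded.\<close>

definition "targets = insert d (tgt ` {1..N})"

definition full :: "(nat \<Rightarrow> int \<Rightarrow> int) \<Rightarrow> int set" where
  "full H = {t. 0 \<le> t \<and> H 5 t = 1 \<and> H 2 t = 1}"

text \<open>The program stores no such set: a vertex is pushed as soon as it is full, so a full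
  vertex missing from the stack has been popped.\<close>

definition expanded :: "store \<Rightarrow> int set" where
  "expanded s = full (snd s) - snd s 4 ` {1..fst s 5}"

text \<open>Lists run from the latest arc downwards, so the untraversed arcs of the current vertex
  are those numbered at most register 4.\<close>

definition pending :: "store \<Rightarrow> int set" where
  "pending s = {a \<in> {1..N}. src a \<notin> expanded s \<or> (src a = fst s 7 \<and> a \<le> fst s 4)}"

definition flags_ok :: "(nat \<Rightarrow> int \<Rightarrow> int) \<Rightarrow> bool" where
  "flags_ok H \<longleftrightarrow> (\<forall>t \<ge> 0. (H 5 t = 0 \<or> H 5 t = 1 \<and> fl t 0) \<and> (H 2 t = 0 \<or> H 2 t = 1 \<and> fl t 1) \<and>
    (H 5 t = 1 \<longrightarrow> t \<in> targets)) \<and> H 5 d = 1 \<and> (\<forall>z \<in> S. H 2 z = 1)"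

definition flag_set :: "(nat \<Rightarrow> int \<Rightarrow> int) \<Rightarrow> int \<Rightarrow> bool" where
  "flag_set H a \<longleftrightarrow> (if knd a = 0 then H 5 (tgt a) = 1 else H 2 (tgt a) = 1)"

text \<open>\<open>flags_ok\<close> carries soundness, as each set flag is derivable; the last
  clause carries completeness, as each traversed arc has delivered its flag.\<close>

definition search_inv :: "store \<Rightarrow> bool" where
  "search_inv s \<longleftrightarrow> regs_ok n m v (fst s) \<and> fst s 15 = fst s 4 + fst s 5 \<and>
    (\<forall>f \<in> {3, 7, 8, 9, 10}. snd s f = G f) \<and> flags_ok (snd s) \<and>
    0 \<le> fst s 5 \<and> inj_on (snd s 4) {1..fst s 5} \<and> snd s 4 ` {1..fst s 5} \<subseteq> full (snd s) \<and>
    0 \<le> fst s 4 \<and> fst s 4 \<le> N \<and> (0 < fst s 4 \<longrightarrow> src (fst s 4) = fst s 7 \<and> fst s 7 \<in> expanded s) \<and>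
    (\<forall>a \<in> {1..N} - pending s. flag_set (snd s) a)"

text \<open>An arc step lowers the first summand and keeps \<open>expanded\<close>; a pop lowers the
  second and adds no pending arc. Together they start at no more than
  \<open>2 * N + 1\<close>.\<close>

definition search_measure :: "store \<Rightarrow> nat" where
  "search_measure s = card (pending s) + card (targets - expanded s)"

lemma finite_targets: "finite targets"
  by (simp add: targets_def)

lemma finite_pending: "finite (pending s)"
  by (rule finite_subset[of _ "{1..N}"]) (auto simp: pending_def)

lemma arcD:
  assumes "1 \<le> a" "a \<le> N"
  shows "is_prev src (src a) (a - 1) (G 7 a)" "0 \<le> tgt a" "0 \<le> src a" "knd a = 0 \<or> knd a = 1"
    "(src a, knd a, tgt a) \<in> arc_set G N" "tgt a \<in> targets"
  using assms ok by (auto simp: arcs_ok_def arc_set_def targets_def)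

lemma full_subset: "flags_ok H \<Longrightarrow> full H \<subseteq> targets"
  by (auto simp: full_def flags_ok_def)

lemma search_inv_init:
  assumes "regs_ok n m v (fst s)" "fst s 4 = 0" "fst s 15 = fst s 5" "0 \<le> fst s 5"
    and "\<forall>f \<in> {3, 7, 8, 9, 10}. snd s f = G f" "flags_ok (snd s)"
    and "inj_on (snd s 4) {1..fst s 5}" "snd s 4 ` {1..fst s 5} = full (snd s)"
  shows "search_inv s"
proof -
  have "expanded s = {}" using assms by (simp add: expanded_def)
  then have "pending s = {1..N}" by (auto simp: pending_def)
  moreover have "0 \<le> N" using ok by (simp add: arcs_ok_def)
  ultimately show ?thesis using assms by (simp add: search_inv_def)
qed

text \<open>The postcondition already performs the final \<open>Plus 15 4 5\<close> of
  \<open>search_body\<close>. The stack is duplicate-free, so popping makes exactly one more vertex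
  expanded.\<close>

lemma pop_step_correct:
  assumes inv: "search_inv s" and cur: "\<not> 0 < fst s 4" and sp: "0 < fst s 15"
  shows "wp pop_step (\<lambda>s'. search_inv (((fst s')(15 := fst s' 4 + fst s' 5)), snd s') \<and>
    search_measure (((fst s')(15 := fst s' 4 + fst s' 5)), snd s') < search_measure s) s"
proof -
  obtain R H where s: "s = (R, H)" by (cases s)
  note inv' = inv[unfolded search_inv_def s fst_conv snd_conv]
  have c0: "R 4 = 0" using cur inv' by (simp add: s)
  have sp0: "0 < R 5" using sp inv' c0 by (simp add: s)
  let ?t = "H 4 (R 5)"
  let ?R = "R(7 := ?t, 5 := R 5 - 1, 4 := G 3 ?t, 15 := G 3 ?t + (R 5 - 1))"
  have t: "?t \<in> full H" using inv' sp0 by auto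
  then have t0: "0 \<le> ?t" by (simp add: full_def)
  have split: "{1..R 5} = insert (R 5) {1..R 5 - 1}" using sp0 by auto
  have notin: "?t \<notin> H 4 ` {1..R 5 - 1}"
    using inv' unfolding split by (auto simp: inj_on_def)
  have exp: "expanded (?R, H) = insert ?t (expanded s)"
    using t notin unfolding expanded_def s by (auto simp: split)
  have tnot: "?t \<notin> expanded s" unfolding expanded_def s using sp0 by auto
  have prev: "is_prev src ?t N (G 3 ?t)" using ok t0 by (simp add: arcs_ok_def)
  have pend: "pending (?R, H) \<subseteq> pending s"
    using tnot by (auto simp: pending_def exp s)
  \<comment> \<open>No arc stops being pending: all arcs of the popped vertex are numbered at most
    its list head, which becomes the current arc.\<close>
  have proc: "a \<in> {1..N} - pending s" if "a \<in> {1..N} - pending (?R, H)" for a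
  proof -
    have a: "1 \<le> a" "a \<le> N" "src a \<in> insert ?t (expanded s)" "\<not> (src a = ?t \<and> a \<le> G 3 ?t)"
      using that by (auto simp: pending_def exp)
    have "src a \<noteq> ?t" using a prev unfolding is_prev_def by (meson not_less)
    then show ?thesis using a c0 by (auto simp: pending_def s)
  qed
  have "search_inv (?R, H)"
    unfolding search_inv_def fst_conv snd_conv
  proof (intro conjI)
    show "inj_on (H 4) {1..?R 5}" using inv' unfolding split by simp
    show "H 4 ` {1..?R 5} \<subseteq> full H" using inv' unfolding split by auto
    show "\<forall>a\<in>{1..N} - pending (?R, H). flag_set H a" using proc inv' by (simp add: s)
    show "0 < ?R 4 \<longrightarrow> src (?R 4) = ?R 7 \<and> ?R 7 \<in> expanded (?R, H)"
      using prev unfolding exp is_prev_def by simp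
  qed (use inv' prev sp0 in \<open>auto simp: is_prev_def regs_ok_def\<close>)
  moreover have "search_measure (?R, H) < search_measure s"
  proof -
    have "?t \<in> targets" using t full_subset inv' by blast
    then have "targets - expanded (?R, H) \<subset> targets - expanded s" using tnot by (auto simp: exp)
    then have "card (targets - expanded (?R, H)) < card (targets - expanded s)"
      by (intro psubset_card_mono) (simp_all add: finite_targets)
    then show ?thesis using card_mono[OF finite_pending pend] by (simp add: search_measure_def)
  qed
  ultimately show ?thesis
    using inv' sp0 t0 by (simp add: pop_step_def s regs_ok_def)
qed

text \<open>Shared by the eight cases given by the kind of the arc and the old values of the
  target's two flags. The source is expanded, hence full, so the flag now set is derivable. A target
  that becomes full enters the stack in the same step, which keeps \<open>expanded\<close>
  unchanged.\<close>

lemma arc_progress: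
  assumes inv: "search_inv s" and cur: "0 < fst s 4"
    and frame: "regs_ok n m v (fst s')" "fst s' 15 = fst s' 4 + fst s' 5" "fst s' 7 = fst s 7"
      "\<forall>f \<in> {3, 7, 8, 9, 10}. snd s' f = G f"
    and next_arc: "fst s' 4 = G 7 (fst s 4)"
    and flags: "\<And>t. 0 \<le> t \<Longrightarrow> snd s' 5 t = (if knd (fst s 4) = 0 \<and> t = tgt (fst s 4) then 1 else snd s 5 t)"
      "\<And>t. 0 \<le> t \<Longrightarrow> snd s' 2 t = (if knd (fst s 4) \<noteq> 0 \<and> t = tgt (fst s 4) then 1 else snd s 2 t)"
    and stack: "if tgt (fst s 4) \<in> full (snd s') - full (snd s)
      then fst s' 5 = fst s 5 + 1 \<and> snd s' 4 (fst s' 5) = tgt (fst s 4) \<and>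
        (\<forall>i \<in> {1..fst s 5}. snd s' 4 i = snd s 4 i)
      else fst s' 5 = fst s 5 \<and> snd s' 4 = snd s 4"
  shows "search_inv s' \<and> search_measure s' < search_measure s"
proof -
  let ?c = "fst s 4" and ?t = "tgt (fst s 4)" and ?p = "G 7 (fst s 4)"
  note inv' = inv[unfolded search_inv_def]
  have c: "1 \<le> ?c" "?c \<le> N" "src ?c = fst s 7" "fst s 7 \<in> expanded s" using inv' cur by auto
  note arc = arcD[OF c(1,2)]
  have F: "flags_ok (snd s)" using inv' by blast
  have "fst s 7 \<in> full (snd s)" using c(4) by (simp add: expanded_def)
  then have "fl (fst s 7) 0" "fl (fst s 7) 1" using F by (auto simp: full_def flags_ok_def)
  then have flt: "fl ?t (knd ?c)" using arc(5) c(3) flagged.arc unfolding fl_def by metis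
  have F': "flags_ok (snd s')"
    using F flt arc(2,4,6) d_nonneg S_nonneg unfolding flags_ok_def by (auto simp: flags)
  have full_mono: "full (snd s) \<subseteq> full (snd s')" by (auto simp: full_def flags)
  have full_new: "full (snd s') \<subseteq> insert ?t (full (snd s))" by (auto simp: full_def flags split: if_splits)
  have stk: "snd s' 4 ` {1..fst s' 5} =
      (if ?t \<in> full (snd s') - full (snd s) then insert ?t (snd s 4 ` {1..fst s 5}) else snd s 4 ` {1..fst s 5})"
    and inj: "inj_on (snd s' 4) {1..fst s' 5}" and sp: "0 \<le> fst s' 5"
  proof -
    have old: "inj_on (snd s 4) {1..fst s 5}" "snd s 4 ` {1..fst s 5} \<subseteq> full (snd s)" "0 \<le> fst s 5"
      using inv' by blast+
    have "snd s' 4 ` {1..fst s' 5} =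
      (if ?t \<in> full (snd s') - full (snd s) then insert ?t (snd s 4 ` {1..fst s 5}) else snd s 4 ` {1..fst s 5}) \<and>
      inj_on (snd s' 4) {1..fst s' 5} \<and> 0 \<le> fst s' 5"
    proof (cases "?t \<in> full (snd s') - full (snd s)")
      case True
      then have st: "fst s' 5 = fst s 5 + 1" "snd s' 4 (fst s' 5) = ?t"
        "\<And>i. i \<in> {1..fst s 5} \<Longrightarrow> snd s' 4 i = snd s 4 i" using stack by auto
      have split: "{1..fst s' 5} = insert (fst s' 5) {1..fst s 5}" using st(1) old(3) by auto
      have im: "snd s' 4 ` {1..fst s 5} = snd s 4 ` {1..fst s 5}" using st(3) by (rule image_cong[OF refl])
      have "inj_on (snd s' 4) {1..fst s 5}" using old(1) st(3) inj_on_cong by blast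
      moreover have "?t \<notin> snd s 4 ` {1..fst s 5}" using True old(2) by blast
      ultimately have "inj_on (snd s' 4) {1..fst s' 5}"
        unfolding split inj_on_insert st(2) using im by blast
      moreover have "snd s' 4 ` {1..fst s' 5} = insert ?t (snd s 4 ` {1..fst s 5})"
        unfolding split using im st(2) by simp
      ultimately show ?thesis using True st(1) old(3) by simp
    next
      case False
      then show ?thesis using stack old unfolding if_not_P[OF False] by simp
    qed
    then show "snd s' 4 ` {1..fst s' 5} =
      (if ?t \<in> full (snd s') - full (snd s) then insert ?t (snd s 4 ` {1..fst s 5}) else snd s 4 ` {1..fst s 5})"
      "inj_on (snd s' 4) {1..fst s' 5}" "0 \<le> fst s' 5" by blast+
  qed
  have old: "snd s 4 ` {1..fst s 5} \<subseteq> full (snd s)" using inv' by blast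
  have exp: "expanded s' = expanded s"
  proof (cases "?t \<in> full (snd s') - full (snd s)")
    case True
    then have "full (snd s') = insert ?t (full (snd s))" using full_mono full_new by blast
    then show ?thesis using True stk old by (auto simp: expanded_def)
  next
    case False
    then have "full (snd s') = full (snd s)" using full_mono full_new by blast
    then show ?thesis using False stk by (simp add: expanded_def)
  qed
  have prev: "0 \<le> ?p" "?p \<le> ?c - 1" "0 < ?p \<longrightarrow> src ?p = fst s 7"
    "\<And>b. ?p < b \<Longrightarrow> b \<le> ?c - 1 \<Longrightarrow> src b \<noteq> fst s 7"
    using arc(1) c(3) by (auto simp: is_prev_def)
  have pend: "pending s' \<subseteq> pending s" "?c \<in> pending s" "?c \<notin> pending s'"
    using c prev by (auto simp: pending_def exp frame next_arc)
  have flag_mono: "flag_set (snd s') a" if "flag_set (snd s) a" "a \<in> {1..N}" for a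
    using that arcD[of a] by (auto simp: flag_set_def flags)
  have flag_c: "flag_set (snd s') ?c" using arc(2) by (simp add: flag_set_def flags)
  \<comment> \<open>The current arc is the only one that leaves \<open>pending\<close>, because no
    arc strictly between its predecessor link and itself has the same source.\<close>
  have proc: "flag_set (snd s') a" if a: "a \<in> {1..N} - pending s'" for a
  proof (cases "a \<in> pending s")
    case True
    then have "src a = fst s 7" "a \<le> ?c" "\<not> a \<le> ?p"
      using a by (auto simp: pending_def exp frame next_arc)
    then have "a = ?c" using prev(4)[of a] by linarith
    then show ?thesis using flag_c by simp
  next
    case False
    then show ?thesis using a inv' flag_mono by blast
  qed
  have "search_inv s'"
    unfolding search_inv_def
  proof (intro conjI)
    show "snd s' 4 ` {1..fst s' 5} \<subseteq> full (snd s')"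
      using stk old full_mono by (auto split: if_splits)
    show "0 < fst s' 4 \<longrightarrow> src (fst s' 4) = fst s' 7 \<and> fst s' 7 \<in> expanded s'"
      using prev(3) c(4) by (simp add: exp frame next_arc)
  qed (use frame F' sp inj proc prev c in \<open>auto simp: next_arc\<close>)
  moreover have "card (pending s') < card (pending s)"
    using pend by (intro psubset_card_mono finite_pending) blast
  then have "search_measure s' < search_measure s" by (simp add: search_measure_def exp)
  ultimately show ?thesis by blast
qed

lemma arc_step_correct:
  assumes inv: "search_inv s" and cur: "0 < fst s 4"
  shows "wp arc_step (\<lambda>s'. search_inv (((fst s')(15 := fst s' 4 + fst s' 5)), snd s') \<and>
    search_measure (((fst s')(15 := fst s' 4 + fst s' 5)), snd s') < search_measure s) s"
proof -
  obtain R H where s: "s = (R, H)" by (cases s)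
  note inv' = inv[unfolded search_inv_def s fst_conv snd_conv]
  have c: "1 \<le> R 4" "R 4 \<le> N" using inv' cur by (auto simp: s)
  note arc = arcD[OF c]
  let ?t = "tgt (R 4)"
  have G: "H 3 = G 3" "H 7 = G 7" "H 8 = G 8" "H 9 = G 9" "H 10 = G 10" using inv' by auto
  have R0: "R 0 = 1" "0 \<le> R 5" "regs_ok n m v R" using inv' by (auto simp: regs_ok_def)
  have f: "H 5 ?t = 0 \<or> H 5 ?t = 1" "H 2 ?t = 0 \<or> H 2 ?t = 1"
    using inv' arc(2) unfolding flags_ok_def by blast+
  note progress = arc_progress[OF inv[unfolded s] cur[unfolded s]]
  have regs: "R 4 \<ge> 0" "R 5 + 1 \<ge> 0" using c R0(2) by auto
  show ?thesis
    using f arc(4) unfolding arc_step_def push_def s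
    by (elim disjE; simp add: G arc regs R0(1,2) heap_upd_apply heap_upd_other)
      (rule progress; use R0 in \<open>auto simp: heap_upd_apply heap_upd_other full_def G arc(2) regs_ok_def\<close>)+
qed

text \<open>On exit the stack is empty and no arc is current, so every full vertex is expanded and
  all its arcs have delivered their flags. The set flags are therefore closed under the rules of
  \<open>flagged\<close>; the converse is \<open>flags_ok\<close>.\<close>

lemma search_loop:
  assumes inv: "search_inv s"
  shows "terminates (While 15 search_body) s ((2 * nat N + 1) * (csize search_body + 1) + 1)
    (\<lambda>s'. regs_ok n m v (fst s') \<and> (\<forall>t \<ge> 0. (snd s' 5 t = 1 \<longleftrightarrow> fl t 0) \<and> (snd s' 2 t = 1 \<longleftrightarrow> fl t 1) \<and> snd s' 5 t \<in> {0, 1} \<and> snd s' 2 t \<in> {0, 1}))"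
proof -
  have body: "wp search_body (\<lambda>s'. search_inv s' \<and> search_measure s' < search_measure s) s"
    if "search_inv s" "0 < fst s 15" for s
  proof -
    have "wp (Ifpos 4 arc_step pop_step) (\<lambda>s'. search_inv (((fst s')(15 := fst s' 4 + fst s' 5)), snd s') \<and>
      search_measure (((fst s')(15 := fst s' 4 + fst s' 5)), snd s') < search_measure s) s"
      using that arc_step_correct[of s] pop_step_correct[of s] by simp
    then show ?thesis unfolding search_body_def by (rule wp_SeqI) simp
  qed
  have "card targets \<le> nat N + 1"
  proof -
    have "card (tgt ` {1..N}) \<le> nat N" using card_image_le[of "{1..N}" tgt] by simp
    then show ?thesis using card_insert_le_m1[of "nat N + 1" "tgt ` {1..N}" d] by (simp add: targets_def)
  qed
  moreover have "card (targets - expanded s) \<le> card targets"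
    by (intro card_mono finite_targets) blast
  moreover have "card (pending s) \<le> nat N"
  proof -
    have "pending s \<subseteq> {1..N}" by (auto simp: pending_def)
    from card_mono[OF _ this] show ?thesis by simp
  qed
  ultimately have "search_measure s \<le> 2 * nat N + 1" by (simp add: search_measure_def)
  from terminates_While[of search_inv s search_measure, OF inv this body] show ?thesis
  proof (rule terminates_mono)
    fix s' assume s': "search_inv s' \<and> \<not> 0 < fst s' 15"
    note inv' = conjunct1[OF s', unfolded search_inv_def]
    have z: "fst s' 4 = 0" "fst s' 5 = 0" using s' inv' by auto
    have F: "flags_ok (snd s')" using inv' by blast
    have exp: "expanded s' = full (snd s')" by (simp add: expanded_def z)
    have closed: "flag_set (snd s') a" if "1 \<le> a" "a \<le> N" "src a \<in> full (snd s')" for a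
      using inv' that by (auto simp: pending_def exp z)
    have complete: "0 \<le> t \<and> (k = 0 \<and> snd s' 5 t = 1 \<or> k = 1 \<and> snd s' 2 t = 1)"
      if "flagged (arc_set G N) S d t k" for t k
      using that
    proof (induction rule: flagged.induct)
      case query
      then show ?case using F d_nonneg by (simp add: flags_ok_def)
    next
      case (preset z)
      then show ?case using F S_nonneg by (simp add: flags_ok_def)
    next
      case (arc v k t)
      then obtain a where a: "1 \<le> a" "a \<le> N" "v = src a" "k = knd a" "t = tgt a"
        by (auto simp: arc_set_def)
      have "src a \<in> full (snd s')" using arc.IH a(3) by (auto simp: full_def)
      from closed[OF a(1,2) this] show ?case using arcD[OF a(1,2)] a by (auto simp: flag_set_def)
    qed
    show "regs_ok n m v (fst s') \<and>
      (\<forall>t \<ge> 0. (snd s' 5 t = 1 \<longleftrightarrow> fl t 0) \<and> (snd s' 2 t = 1 \<longleftrightarrow> fl t 1) \<and> snd s' 5 t \<in> {0, 1} \<and> snd s' 2 t \<in> {0, 1})"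
    proof (intro conjI[OF conjunct1[OF inv']] allI impI)
      fix t :: int assume "0 \<le> t"
      then show "(snd s' 5 t = 1 \<longleftrightarrow> fl t 0) \<and> (snd s' 2 t = 1 \<longleftrightarrow> fl t 1) \<and> snd s' 5 t \<in> {0, 1} \<and> snd s' 2 t \<in> {0, 1}"
        using F complete[of t 0] complete[of t 1] unfolding fl_def flags_ok_def by auto
    qed
  qed
qed

end

section \<open>Flags and the backward closure\<close>

lemma flagged_sound:
  assumes eg: "event_graph n lab es" and v: "v < n"
    and "flagged (node_arcs lab n \<union> edge_arcs es) (preset lab X n) (node v) t k"
  shows "(\<forall>w < n. t = node w \<longrightarrow>
      (k = 0 \<longrightarrow> w = v \<or> (\<exists>u. back_reach n lab es v X u \<and> adj es u w)) \<and>
      (k = 1 \<longrightarrow> agrees lab X w \<or> (\<exists>w'. back_reach n lab es v X w' \<and> snd (lab w') = snd (lab w)))) \<and>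
    (\<forall>x. t = hub x \<longrightarrow> k = 0 \<longrightarrow> (\<exists>w. back_reach n lab es v X w \<and> snd (lab w) = x))"
  using assms(3)
proof (induction rule: flagged.induct)
  case query
  then show ?case by simp
next
  case (preset z)
  then show ?case by (auto simp: preset_def)
next
  case (arc s k t)
  let ?B = "back_reach n lab es v X"
  \<comment> \<open>A single flag does not make a node reached, so the induction gives each flag its
    own meaning; the two together match a rule of \<open>back_reach\<close>. If \<open>u = v\<close>
    and only its element is known to be met, \<open>back_reach_start\<close> supplies
    \<open>v\<close>.\<close>
  have node: "?B u" if s: "s = node u" and u: "u < n" for u
  proof -
    have "u = v \<or> (\<exists>w. ?B w \<and> adj es w u)"
      "agrees lab X u \<or> (\<exists>w'. ?B w' \<and> snd (lab w') = snd (lab u))"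
      using arc.IH s u by blast+
    then show ?thesis using start[OF v] back_reach_start agree[OF _ _ u] seen[OF _ _ u] by metis
  qed
  from arc.hyps(1) consider
      (to_hub) u where "u < n" "s = node u" "k = 0" "t = hub (snd (lab u))"
    | (to_node) u where "u < n" "s = hub (snd (lab u))" "k = 1" "t = node u"
    | (edge) u w where "adj es u w" "s = node u" "k = 0" "t = node w"
    unfolding node_arcs_def edge_arcs_def adj_def by auto
  then show ?case
  proof cases
    case to_hub
    then show ?thesis using node by auto
  next
    case to_node
    have "\<exists>w. ?B w \<and> snd (lab w) = snd (lab u)" using arc.IH to_node(2) by blast
    then show ?thesis using to_node by auto
  next
    case edge
    have "?B u" using node[OF edge(2)] event_graph_adj_less[OF eg edge(1)] by blast
    then show ?thesis using edge by auto
  qed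
qed

lemma back_reach_flagged:
  assumes eg: "event_graph n lab es" and "back_reach n lab es v X w"
  shows "w < n \<and> flagged (node_arcs lab n \<union> edge_arcs es) (preset lab X n) (node v) (node w) 0 \<and>
    flagged (node_arcs lab n \<union> edge_arcs es) (preset lab X n) (node v) (node w) 1"
  using assms(2)
proof (induction rule: back_reach.induct)
  case start
  then show ?case by (auto simp: preset_def intro: flagged.intros)
next
  case (agree u w)
  have "(node u, 0, node w) \<in> node_arcs lab n \<union> edge_arcs es"
    using agree.hyps(2) by (auto simp: adj_def edge_arcs_def)
  from flagged.arc[OF this] agree show ?case by (auto simp: preset_def intro: flagged.preset)
next
  case (seen u w w')
  let ?A = "node_arcs lab n \<union> edge_arcs es"
  have "(node u, 0, node w) \<in> ?A"
    using seen.hyps(2) by (auto simp: adj_def edge_arcs_def)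
  note w0 = flagged.arc[OF this, where S = "preset lab X n" and d = "node v"]
  \<comment> \<open>Rule \<open>seen\<close> becomes two arcs: \<open>w'\<close> activates the hub
    of the common element, and the hub releases \<open>w\<close>.\<close>
  have "(node w', 0, hub (snd (lab w))) \<in> ?A"
    using seen.IH(2) seen.hyps(5) by (auto simp: node_arcs_def)
  note h0 = flagged.arc[OF this, where S = "preset lab X n" and d = "node v"]
  have "hub (snd (lab w)) \<in> preset lab X n" using seen.hyps(3) by (auto simp: preset_def)
  note h1 = flagged.preset[OF this, where A = ?A and d = "node v"]
  have "(hub (snd (lab w)), 1, node w) \<in> ?A" using seen.hyps(3) by (auto simp: node_arcs_def)
  note w1 = flagged.arc[OF this, where S = "preset lab X n" and d = "node v"]
  show ?case using seen.hyps(3) seen.IH w0 w1 h0 h1 by blast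
qed

lemma flagged_iff_back_reach:
  assumes eg: "event_graph n lab es" and v: "v < n" and w: "w < n"
  shows "flagged (node_arcs lab n \<union> edge_arcs es) (preset lab X n) (node v) (node w) 0 \<and>
    flagged (node_arcs lab n \<union> edge_arcs es) (preset lab X n) (node v) (node w) 1 \<longleftrightarrow>
    back_reach n lab es v X w" (is "?F0 \<and> ?F1 \<longleftrightarrow> ?B w")
proof
  assume "?F0 \<and> ?F1"
  then have "w = v \<or> (\<exists>u. ?B u \<and> adj es u w)"
    "agrees lab X w \<or> (\<exists>w'. ?B w' \<and> snd (lab w') = snd (lab w))"
    using flagged_sound[OF eg v, of X "node w" 0] flagged_sound[OF eg v, of X "node w" 1] w by simp_all
  then show "?B w" using start[OF v] back_reach_start agree[OF _ _ w] seen[OF _ _ w] by metis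
qed (use back_reach_flagged[OF eg] in blast)

section \<open>Final check and assembly of the program\<close>

definition check_body :: com where
  "check_body = Fetch 7 5 5 ;; Fetch 9 2 5 ;;
    Ifpos 7 (Ifpos 9 (Const 12 0) (Const 6 0)) (Const 6 0) ;; Plus 5 5 13 ;; Minus 4 4 0"

lemma check_loop:
  assumes "regs_ok n m v (fst s)" "fst s 4 = int n" "fst s 5 = 2" "fst s 6 = 1"
    and flags: "\<forall>t \<ge> 0. (snd s 5 t = 1 \<longleftrightarrow> F t 0) \<and> (snd s 2 t = 1 \<longleftrightarrow> F t 1) \<and>
      snd s 5 t \<in> {0, 1} \<and> snd s 2 t \<in> {0, 1}"
  shows "terminates (While 4 check_body) s (n * (csize check_body + 1) + 1)
    (\<lambda>s'. fst s' 6 \<noteq> 0 \<longleftrightarrow> (\<forall>u < n. F (node u) (0 :: int) \<and> F (node u) (1 :: int)))"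
proof -
  let ?ok = "\<lambda>u. F (node u) 0 \<and> F (node u) 1"
  let ?J = "\<lambda>i s'. i \<le> n \<and> regs_ok n m v (fst s') \<and> fst s' 4 = int n - int i \<and> fst s' 5 = node i \<and>
    snd s' = snd s \<and> fst s' 6 = of_bool (\<forall>u < i. ?ok u)"
  let ?I = "\<lambda>s'. \<exists>i. ?J i s'"
  have body: "wp check_body (\<lambda>s''. ?I s'' \<and> nat (fst s'' 4) < nat (fst s' 4)) s'"
    if I: "?I s'" and pos: "0 < fst s' 4" for s'
  proof -
    obtain i where i: "?J i s'" using I by blast
    have lt: "i < n" using i pos by simp
    have "wp check_body (?J (Suc i)) s'"
    proof -
      have f: "snd s 5 (node i) = of_bool (F (node i) 0)" "snd s 2 (node i) = of_bool (F (node i) 1)"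
        using flags[rule_format, of "node i"] by auto
      have all: "(\<forall>u < Suc i. ?ok u) \<longleftrightarrow> (\<forall>u < i. ?ok u) \<and> ?ok i"
        by (auto simp: less_Suc_eq)
      have nS: "node i + 2 = node (Suc i)" by (simp add: node_def)
      show ?thesis using i lt unfolding all
        by (cases "F (node i) 0"; cases "F (node i) 1")
          (simp_all add: check_body_def regs_ok_def f nS)
    qed
    then show ?thesis
    proof (rule wp_mono)
      fix s'' assume s'': "?J (Suc i) s''"
      then have "nat (fst s'' 4) < nat (fst s' 4)" using i lt by simp
      with s'' show "?I s'' \<and> nat (fst s'' 4) < nat (fst s' 4)" by blast
    qed
  qed
  have "?J 0 s" using assms by (simp add: node_def)
  then have "?I s" by blast
  moreover have "nat (fst s 4) \<le> n" using assms by simp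
  ultimately have "terminates (While 4 check_body) s (n * (csize check_body + 1) + 1) (\<lambda>s'. ?I s' \<and> \<not> 0 < fst s' 4)"
    using body by (rule terminates_While)
  then show ?thesis
  proof (rule terminates_mono)
    fix s' assume "?I s' \<and> \<not> 0 < fst s' 4"
    then obtain i where i: "?J i s'" "\<not> 0 < fst s' 4" by blast
    then have "i = n" by simp
    then show "fst s' 6 \<noteq> 0 \<longleftrightarrow> (\<forall>u < n. ?ok u)" using i by simp
  qed
qed

definition query_setup :: com where
  "query_setup = Plus 6 3 3 ;; Plus 6 6 13 ;; Put 5 6 0 ;; Const 5 0 ;; Const 4 0 ;; Const 7 0 ;;
    Fetch 9 2 6 ;; Ifpos 9 push (Const 12 0) ;; Plus 15 4 5"

lemma query_setup_correct:
  assumes inv: "edge_inv n lab es v xs (length es) s"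
  shows "search (snd s) (fst s 8) (preset lab (set xs) n) (node v)"
    and "wp query_setup (search.search_inv (snd s) (fst s 8) (preset lab (set xs) n) (node v) n (length es) v) s"
proof -
  note inv' = inv[unfolded edge_inv_def]
  show search: "search (snd s) (fst s 8) (preset lab (set xs) n) (node v)"
    using inv' by unfold_locales (auto simp: preset_def)
  interpret search "snd s" "fst s 8" "preset lab (set xs) n" "node v" n "length es" v by (rule search)
  let ?H = "heap_upd (snd s) 5 (node v) 1"
  have regs: "fst s 0 = 1" "fst s 3 = int v" "fst s 13 = 2" "fst s 14 = 0" using inv' by (auto simp: regs_ok_def)
  have nv: "2 * int v + 2 = node v" by (simp add: node_def)
  have fl0: "fl (node v) 0" "z \<in> preset lab (set xs) n \<Longrightarrow> fl z 1" for z
    unfolding fl_def by (rule flagged.query, rule flagged.preset)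
  have S: "snd s 2 z = of_bool (z \<in> preset lab (set xs) n)" "snd s 5 z = 0" if "0 \<le> z" for z
    using inv' that by auto
  have flags: "flags_ok H'" if "H' 5 = (snd s 5)(node v := 1)" "H' 2 = snd s 2" for H'
    using that S fl0 S_nonneg by (auto simp: flags_ok_def targets_def)
  \<comment> \<open>The query node is the only vertex with flag 0 at this point, so the initial
    stack holds it or is empty, according to whether its label agrees with the query set.\<close>
  have full: "full H' = (if node v \<in> preset lab (set xs) n then {node v} else {})"
    if "H' 5 = (snd s 5)(node v := 1)" "H' 2 = snd s 2" for H'
    using that S by (auto simp: full_def)
  show "wp query_setup search_inv s"
  proof (cases "node v \<in> preset lab (set xs) n")
    case True
    let ?H' = "heap_upd ?H 4 1 (node v)"
    have h: "?H' 5 = (snd s 5)(node v := 1)" "?H' 2 = snd s 2"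
      by (simp_all add: heap_upd_def)
    let ?R = "(fst s)(6 := node v, 5 := 0, 4 := 0, 7 := 0, 9 := 1, 5 := 1, 15 := 1)"
    have "search_inv (?R, ?H')"
    proof (rule search_inv_init)
      show "flags_ok (snd (?R, ?H'))" using flags[of ?H', OF h] by simp
      show "snd (?R, ?H') 4 ` {1..fst (?R, ?H') 5} = full (snd (?R, ?H'))"
        using full[of ?H', OF h] True by (simp add: heap_upd_apply)
    qed (use inv' in \<open>auto simp: regs_ok_def heap_upd_other\<close>)
    then show ?thesis
      by (simp add: query_setup_def push_def regs nv heap_upd_other S True)
  next
    case False
    have h: "?H 5 = (snd s 5)(node v := 1)" "?H 2 = snd s 2"
      by (simp_all add: heap_upd_def)
    let ?R = "(fst s)(6 := node v, 5 := 0, 4 := 0, 7 := 0, 9 := 0, 12 := 0, 15 := 0)"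
    have "search_inv (?R, ?H)"
    proof (rule search_inv_init)
      show "flags_ok (snd (?R, ?H))" using flags[of ?H, OF h] by simp
      show "snd (?R, ?H) 4 ` {1..fst (?R, ?H) 5} = full (snd (?R, ?H))"
        using full[of ?H, OF h] False by simp
    qed (use inv' in \<open>auto simp: regs_ok_def heap_upd_other\<close>)
    then show ?thesis
      by (simp add: query_setup_def push_def regs nv heap_upd_other S False)
  qed
qed

definition check_setup :: com where
  "check_setup = Plus 4 1 14 ;; Const 5 2 ;; Const 6 1"

definition main_com :: com where
  "main_com = load_header ;; While 4 mark_body ;; (Const 5 4 ;; Plus 4 1 14) ;; While 4 node_body ;;
    Plus 4 2 14 ;; While 4 edge_body ;; (query_setup ;; While 15 search_body) ;;
    check_setup ;; While 4 check_body"

text \<open>Nested to the right like the sequence in \<open>main_com\<close>, so that chaining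
  \<open>terminates_Seq\<close> produces exactly this term. The search is charged for
  \<open>2 * n + 2 * m\<close> arcs: two per node and two per edge.\<close>

definition main_cost :: "nat \<Rightarrow> nat \<Rightarrow> nat \<Rightarrow> nat" where
  "main_cost n m k = csize load_header + (k * (csize mark_body + 1) + 1 + (csize (Const 5 4 ;; Plus 4 1 14) +
    (n * (csize node_body + 1) + 1 + (csize (Plus 4 2 14) + (m * (csize edge_body + 1) + 1 +
    (csize query_setup + ((2 * (2 * n + 2 * m) + 1) * (csize search_body + 1) + 1) +
    (csize check_setup + (n * (csize check_body + 1) + 1))))))))"

lemma main_com_correct:
  assumes eg: "event_graph n lab es" and v: "v < n"
    and inp: "input_ok n lab es v xs (H 15)"
    and zero: "\<forall>k z. 1 \<le> k \<and> k \<le> 14 \<and> 0 \<le> z \<longrightarrow> H k z = 0"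
  shows "terminates main_com (R, H) (main_cost n (length es) (length xs))
    (\<lambda>s. fst s 6 \<noteq> 0 \<longleftrightarrow> (\<forall>w < n. back_reach n lab es v (set xs) w))"
proof -
  let ?F = "flagged (node_arcs lab n \<union> edge_arcs es) (preset lab (set xs) n) (node v)"
  let ?Q1 = "\<lambda>s. input_ok n lab es v xs (snd s 15) \<and> regs_ok n (length es) v (fst s) \<and>
      fst s 4 = int (length xs) \<and> fst s 5 = 4 + 2 * int n + 2 * int (length es) \<and>
      (\<forall>z \<ge> 0. snd s 6 z = 0) \<and> blank (snd s) \<and> fst s 8 = 0"
  let ?Q2 = "\<lambda>(R, H). input_ok n lab es v xs (H 15) \<and> regs_ok n (length es) v R \<and>
      (\<forall>z \<ge> 0. H 6 z = of_bool (z \<in> int ` set xs)) \<and> blank H \<and> R 8 = 0"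
  define closed :: "(nat \<Rightarrow> int \<Rightarrow> int) \<Rightarrow> bool" where
    "closed H \<longleftrightarrow> (\<forall>t \<ge> 0. (H 5 t = 1 \<longleftrightarrow> ?F t 0) \<and> (H 2 t = 1 \<longleftrightarrow> ?F t 1) \<and> H 5 t \<in> {0, 1} \<and> H 2 t \<in> {0, 1})" for H
  let ?Q5 = "\<lambda>s. regs_ok n (length es) v (fst s) \<and> closed (snd s)"
  let ?Q6 = "\<lambda>s. ?Q5 s \<and> fst s 4 = int n \<and> fst s 5 = 2 \<and> fst s 6 = 1"
  have header: "wp load_header ?Q1 (R, H)"
    using input_okD(1-4)[OF inp] zero inp by (simp add: load_header_def regs_ok_def blank_def)
  have mark: "terminates (While 4 mark_body) s (length xs * (csize mark_body + 1) + 1) ?Q2" if "?Q1 s" for s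
    using mark_loop[of n lab es v xs "snd s" "fst s"] that by simp
  have node_setup: "wp (Const 5 4 ;; Plus 4 1 14) (node_inv n lab es v xs 0) s" if "?Q2 s" for s
    using that by (cases s) (auto simp: node_inv_def regs_ok_def blank_def preset_def arcs_ok_def
        is_prev_def arc_set_def node_arcs_def)
  have edge_setup: "wp (Plus 4 2 14) (edge_inv n lab es v xs 0) s" if "node_inv n lab es v xs n s" for s
    using that by (auto simp: node_inv_def edge_inv_def regs_ok_def edge_arcs_def)
  have search: "terminates (query_setup ;; While 15 search_body) s
      (csize query_setup + ((2 * (2 * n + 2 * length es) + 1) * (csize search_body + 1) + 1)) ?Q5"
    if inv: "edge_inv n lab es v xs (length es) s" for s
  proof -
    note q = query_setup_correct[OF inv]
    have "nat (fst s 8) = 2 * n + 2 * length es" "arc_set (snd s) (fst s 8) = node_arcs lab n \<union> edge_arcs es"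
      using inv by (auto simp: edge_inv_def)
    then show ?thesis
      using terminates_Seq[OF wp_terminates[OF q(2)] search.search_loop[OF q(1)]]
      by (simp only: search.fl_def[OF q(1)] closed_def)
  qed
  have check_setup: "wp check_setup ?Q6 s" if "?Q5 s" for s
    using that by (simp add: check_setup_def regs_ok_def)
  have check: "terminates (While 4 check_body) s (n * (csize check_body + 1) + 1)
      (\<lambda>s'. fst s' 6 \<noteq> 0 \<longleftrightarrow> (\<forall>w < n. back_reach n lab es v (set xs) w))"
    if q: "?Q6 s" for s
  proof -
    have "terminates (While 4 check_body) s (n * (csize check_body + 1) + 1)
      (\<lambda>s'. fst s' 6 \<noteq> 0 \<longleftrightarrow> (\<forall>u < n. ?F (node u) 0 \<and> ?F (node u) 1))"
      using q unfolding closed_def by (intro check_loop) blast+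
    then show ?thesis
      by (rule terminates_mono) (simp add: flagged_iff_back_reach[OF eg v])
  qed
  show ?thesis
    unfolding main_com_def main_cost_def
    by (rule terminates_Seq[OF wp_terminates[OF header]], rule terminates_Seq[OF mark], assumption,
        rule terminates_Seq[OF wp_terminates[OF node_setup]], assumption,
        rule terminates_Seq[OF node_loop], assumption,
        rule terminates_Seq[OF wp_terminates[OF edge_setup]], assumption,
        rule terminates_Seq[OF edge_loop], assumption,
        rule terminates_Seq[OF search], assumption,
        rule terminates_Seq[OF wp_terminates[OF check_setup]], assumption, rule check)
qed

text \<open>The answer is in register 6, that is, in cell 8.\<close>

definition decide_sink :: "instr list" where
  "decide_sink = prologue @ compile 42 main_com @ [LoadConst 1 0, Add 0 8 1]"

lemma decide_sink_correct:
  assumes eg: "event_graph n lab es" and v: "v < n" and X: "set xs \<subseteq> elems n lab"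
  shows "\<exists>t. t \<le> 8 * (2 * n + 2 * length es + length xs) + 25 + 9 * main_cost n (length es) (length xs) + 2 \<and>
    ram_halted decide_sink (ram_run decide_sink t (0, input_mem n lab es v xs)) \<and>
    (snd (ram_run decide_sink t (0, input_mem n lab es v xs)) 0 \<noteq> 0 \<longleftrightarrow>
      (\<exists>C. dec_sink_component n lab es C \<and> (v, set xs) \<in> C))"
proof -
  let ?P = decide_sink and ?I = "input_mem n lab es v xs"
  have n: "0 < n" using v by simp
  obtain i M R H where 1: "i \<le> 8 * (2 * n + 2 * length es + length xs) + 25"
    "ram_run ?P i (0, ?I) = (42, M)" "simulates M (R, H)"
    and H: "\<forall>z \<ge> 0. H 15 z = ?I z" "\<forall>k z. 1 \<le> k \<and> k \<le> 14 \<and> 0 \<le> z \<longrightarrow> H k z = 0"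
    using run_prologue[where lab = lab and es = es and v = v and xs = xs
        and Q = "compile 42 main_com @ [LoadConst 1 0, Add 0 8 1]", OF refl n]
    unfolding decide_sink_def by blast
  have "input_ok n lab es v xs (H 15)" using H(1) by (simp add: input_ok_def)
  from main_com_correct[OF eg v this H(2)] obtain t s where
    2: "t \<le> main_cost n (length es) (length xs)" "exec main_com (R, H) t s"
      "fst s 6 \<noteq> 0 \<longleftrightarrow> (\<forall>w < n. back_reach n lab es v (set xs) w)"
    unfolding terminates_def by blast
  have code: "code_at ?P 42 (compile 42 main_com @ [LoadConst 1 0, Add 0 8 1])"
    unfolding code_at_def decide_sink_def
    by (intro exI[of _ prologue] exI[of _ "[]"]) (simp add: length_prologue)
  then have code': "code_at ?P 42 (compile 42 main_com)"
    "code_at ?P (42 + csize main_com) [LoadConst 1 0, Add 0 8 1]"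
    unfolding code_at_append by simp_all
  obtain j M' where 3: "j \<le> 9 * t" "ram_run ?P j (42, M) = (42 + csize main_com, M')" "simulates M' s"
    using compile_correct[OF 2(2) 1(3) code'(1)] by blast
  have M8: "M' 8 = fst s 6" using 3(3) by (auto simp: simulates_def dest!: spec[of _ 6])
  have 4: "ram_run ?P 2 (42 + csize main_com, M') = (44 + csize main_com, M'(1 := 0, 0 := fst s 6))"
    using code'(2) M8 by (simp add: code_at_Cons eval_nat_numeral ram_run_Suc ram_step_instr)
  have run: "ram_run ?P (i + (j + 2)) (0, ?I) = (44 + csize main_com, M'(1 := 0, 0 := fst s 6))"
    by (simp only: ram_run_add 1(2) 3(2) 4)
  \<comment> \<open>The code contains no \<open>Halt\<close>; the run ends with the program counter
    equal to the program length, which counts as halted.\<close>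
  have len: "length ?P = 44 + csize main_com" by (simp add: decide_sink_def length_prologue)
  show ?thesis
  proof (intro exI conjI)
    show "i + (j + 2) \<le> 8 * (2 * n + 2 * length es + length xs) + 25 + 9 * main_cost n (length es) (length xs) + 2"
      using 1(1) 2(1) 3(1) by linarith
    show "ram_halted ?P (ram_run ?P (i + (j + 2)) (0, ?I))"
      unfolding run by (simp add: ram_halted_def len)
    show "snd (ram_run ?P (i + (j + 2)) (0, ?I)) 0 \<noteq> 0 \<longleftrightarrow> (\<exists>C. dec_sink_component n lab es C \<and> (v, set xs) \<in> C)"
      unfolding run using 2(3) sink_iff_back_reach[OF eg v X] by simp
  qed
qed

text \<open>A list without repetitions over the elements of \<open>n\<close> nodes has at most
  \<open>n\<close> entries, which absorbs reading the query set into the bound in \<open>n\<close>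
  and the number of edges.\<close>

lemma distinct_elems_length:
  assumes "distinct xs" "set xs \<subseteq> elems n lab"
  shows "length xs \<le> n"
proof -
  have e: "elems n lab = (snd \<circ> lab) ` {..<n}" by (auto simp: elems_def)
  have "length xs = card (set xs)" using assms(1) by (simp add: distinct_card)
  also have "\<dots> \<le> card (elems n lab)" using assms(2) by (intro card_mono) (auto simp: e)
  also have "\<dots> \<le> n" using card_image_le[of "{..<n}" "snd \<circ> lab"] by (simp add: e)
  finally show ?thesis .
qed

theorem mainTheorem6:
  "\<exists>(P :: instr list) (c :: nat). \<forall>n lab es v xs.
     event_graph n lab es \<and> v < n \<and> distinct xs \<and> set xs \<subseteq> elems n lab \<longrightarrow>
     (\<exists>t. t \<le> c * (n + length es + 1) \<and>
        ram_halted P (ram_run P t (0, input_mem n lab es v xs)) \<and>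
        (snd (ram_run P t (0, input_mem n lab es v xs)) 0 \<noteq> 0 \<longleftrightarrow>
          (\<exists>C. dec_sink_component n lab es C \<and> (v, set xs) \<in> C)))"
proof -
  \<comment> \<open>10000 is a round number above the coefficients of \<open>n\<close> and
    \<open>m\<close> and the constant term obtained by unfolding all command sizes.\<close>
  have c: "8 * (2 * n + 2 * m + k) + 25 + 9 * main_cost n m k + 2 \<le> 10000 * (n + m + 1)"
    if "k \<le> n" for n m k
    using that
    by (simp add: main_cost_def load_header_def mark_body_def node_body_def edge_body_def query_setup_def
        search_body_def arc_step_def pop_step_def push_def check_setup_def check_body_def emit_def)
  show ?thesis
  proof (rule exI[of _ decide_sink], rule exI[of _ 10000], intro allI impI)
    fix n lab es v xs
    assume a: "event_graph n lab es \<and> v < n \<and> distinct xs \<and> set xs \<subseteq> elems n lab"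
    then have "length xs \<le> n" using distinct_elems_length by blast
    from c[OF this, of "length es"] decide_sink_correct[of n lab es v xs] a
    show "\<exists>t. t \<le> 10000 * (n + length es + 1) \<and>
        ram_halted decide_sink (ram_run decide_sink t (0, input_mem n lab es v xs)) \<and>
        (snd (ram_run decide_sink t (0, input_mem n lab es v xs)) 0 \<noteq> 0 \<longleftrightarrow>
          (\<exists>C. dec_sink_component n lab es C \<and> (v, set xs) \<in> C))"
      using order_trans by blast
  qed
qed

end
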